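(* Let $U$ and $V$ be groups with torsion, $G=(U\wr\mathbb{Z})\times(V\wr\mathbb{Z})$, $e$ a nontrivial projection in $\mathbb{C}[U]$ and $f$ a nontrivial projection in $\mathbb{C}[V]$. Let $X=(\mathrm{tr}_U(e))^{-1}$ and $Y=(\mathrm{tr}_V(f))^{-1}$ (so $X>1$, $Y>1$). Let $T=e\,t_U+t_U^{-1}e\in\mathbb{C}[U\wr\mathbb{Z}]\subset\mathbb{C}[G]$ and $S=f\,t_V+t_V^{-1}f\in\mathbb{C}[V\wr\mathbb{Z}]\subset\mathbb{C}[G]$. Then \[ \dim_G(\ker(T-S))=(X-1)^2(Y-1)^2\Big(\sum_{m\ge1}\sum_{n\ge1}\frac{\gcd(m,n)}{X^mY^n}\Big)-(X-1)(Y-1). \]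
   Context: For a group $U$, $U\wr\mathbb{Z}=(\bigoplus_{i\in\mathbb{Z}}U)\rtimes C_\infty$, where $C_\infty$ is infinite cyclic with generator $t_U$ acting by the shift $t_U^{-1}((g_n)_{n})t_U=(g_{n-1})_n$; $U$ is identified with the subgroup of elements $(\dots,1,u,1,\dots)$ with $u$ in position $0$. A nontrivial projection means $p=p^*=p^2$, $p\ne0,1$. For a group $H$, $\mathrm{tr}_H$ on $\mathbb{C}[H]$ is the coefficient of $1$, extended to the group von Neumann algebra $\mathcal N(H)$ by $\mathrm{tr}_H(a)=\langle a(1),1\rangle_{l^2(H)}$; elements of $\mathbb{C}[G]$ act on $l^2(G)$ by left multiplication, and $\dim_G(\ker(T-S))$ is $\mathrm{tr}_G$ of the orthogonal projection of $l^2(G)$ onto $\ker(T-S)$. *)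

theory Defs
  imports "HOL-Analysis.Analysis" "HOL-Library.Product_Plus"
begin

text \<open>Groups are represented by types of class group_add (a not necessarily
commutative group, written additively: 0 is the identity, + the product,
unary minus the inverse).\<close>

text \<open>An element (g, k) stands for g t^k, where g is a finitely supported
sequence in U (an element of the direct sum) and t the generator of the
infinite cyclic group.  The relation t^-1 g t = (n |-> g (n-1)) gives
t^k g t^-k = (n |-> g (n+k)), hence the product below.\<close>

typedef (overloaded) ('u::group_add) wr =
  "{p :: (int \<Rightarrow> 'u) \<times> int. finite {i. fst p i \<noteq> 0}}"
  morphisms rep_wr abs_wr
  by (rule exI[of _ "(\<lambda>_. 0, 0)"]) simp

lemma rep_wr_fin: "finite {i. fst (rep_wr a) i \<noteq> 0}"
  using rep_wr[of a] by simp

lemma abs_wr_inverse': "finite {i. f i \<noteq> 0} \<Longrightarrow> rep_wr (abs_wr (f, k)) = (f, k)"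
  by (simp add: abs_wr_inverse)

lemma fin_shift:
  assumes "finite {i. (g::int\<Rightarrow>'u::zero) i \<noteq> 0}"
  shows "finite {n. g (n + k) \<noteq> 0}"
proof -
  have "{n. g (n + k) \<noteq> 0} = (\<lambda>i. i - k) ` {i. g i \<noteq> 0}"
    by (auto simp: image_iff intro!: exI[of _ "_ + k"])
  thus ?thesis using assms by simp
qed

lemma fin_plus:
  assumes "finite {i. (f::int\<Rightarrow>'u::monoid_add) i \<noteq> 0}" "finite {i. g i \<noteq> 0}"
  shows "finite {n. f n + g n \<noteq> 0}"
  by (rule finite_subset[OF _ finite_UnI[OF assms]]) auto

lemma fin_uminus:
  assumes "finite {i. (f::int\<Rightarrow>'u::group_add) i \<noteq> 0}"
  shows "finite {n. - f n \<noteq> 0}"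
  using assms by simp

instantiation wr :: (group_add) group_add
begin

definition zero_wr :: "'a wr" where
  "zero_wr = abs_wr (\<lambda>_. 0, 0)"

definition plus_wr :: "'a wr \<Rightarrow> 'a wr \<Rightarrow> 'a wr" where
  "plus_wr a b = abs_wr (\<lambda>n. fst (rep_wr a) n + fst (rep_wr b) (n + snd (rep_wr a)),
                          snd (rep_wr a) + snd (rep_wr b))"

definition uminus_wr :: "'a wr \<Rightarrow> 'a wr" where
  "uminus_wr a = abs_wr (\<lambda>n. - fst (rep_wr a) (n - snd (rep_wr a)), - snd (rep_wr a))"

definition minus_wr :: "'a wr \<Rightarrow> 'a wr \<Rightarrow> 'a wr" where
  "minus_wr a b = a + - b"

lemma rep_plus:
  "rep_wr (a + b) = (\<lambda>n. fst (rep_wr a) n + fst (rep_wr b) (n + snd (rep_wr a)),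
                          snd (rep_wr a) + snd (rep_wr b))"
  unfolding plus_wr_def
  by (rule abs_wr_inverse') (intro fin_plus fin_shift rep_wr_fin)

lemma rep_uminus:
  "rep_wr (- a) = (\<lambda>n. - fst (rep_wr a) (n - snd (rep_wr a)), - snd (rep_wr a))"
  unfolding uminus_wr_def
  by (rule abs_wr_inverse') (simp add: fin_shift[OF rep_wr_fin, of a "- snd (rep_wr a)", simplified])

lemma rep_zero: "rep_wr (0::'a wr) = (\<lambda>_. 0, 0)"
  unfolding zero_wr_def by (rule abs_wr_inverse') simp

instance
proof
  fix a b c :: "'a wr"
  show "a + b + c = a + (b + c)"
    by (rule rep_wr_inject[THEN iffD1]) (simp add: rep_plus add.assoc algebra_simps)
  show "0 + a = a"
    by (rule rep_wr_inject[THEN iffD1]) (simp add: rep_plus rep_zero)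
  show "a + 0 = a"
    by (rule rep_wr_inject[THEN iffD1]) (simp add: rep_plus rep_zero)
  show "- a + a = 0"
    by (rule rep_wr_inject[THEN iffD1]) (simp add: rep_plus rep_zero rep_uminus)
  show "a + - b = a - b"
    by (simp add: minus_wr_def)
qed

end

definition wr_base :: "'u::group_add \<Rightarrow> 'u wr" where
  "wr_base u = abs_wr ((\<lambda>_. 0)(0 := u), 0)"

definition wr_t :: "'u::group_add wr" where
  "wr_t = abs_wr (\<lambda>_. 0, 1)"

definition supp :: "('g \<Rightarrow> complex) \<Rightarrow> 'g set" where
  "supp a = {x. a x \<noteq> 0}"

definition group_ring :: "('g \<Rightarrow> complex) set" where
  "group_ring = {a. finite (supp a)}"

definition delta :: "'g \<Rightarrow> 'g \<Rightarrow> complex" where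
  "delta g = (\<lambda>x. if x = g then 1 else 0)"

text \<open>Convolution (a*b)(x) = sum over y of a(y) b(y^-1 x); for a in C[H] and
b in C[H] or l2(H) this is the product / left multiplication by a.\<close>
definition conv :: "('g::group_add \<Rightarrow> complex) \<Rightarrow> ('g \<Rightarrow> complex) \<Rightarrow> 'g \<Rightarrow> complex" where
  "conv a b = (\<lambda>x. \<Sum>y\<in>supp a. a y * b (- y + x))"

definition gstar :: "('g::group_add \<Rightarrow> complex) \<Rightarrow> 'g \<Rightarrow> complex" where
  "gstar a = (\<lambda>x. cnj (a (- x)))"

definition nontrivial_projection :: "('g::group_add \<Rightarrow> complex) \<Rightarrow> bool" where
  "nontrivial_projection p \<longleftrightarrow> p \<in> group_ring \<and> gstar p = p \<and> conv p p = p
      \<and> p \<noteq> (\<lambda>_. 0) \<and> p \<noteq> delta 0"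

definition tr :: "('g::group_add \<Rightarrow> complex) \<Rightarrow> complex" where
  "tr a = a 0"

definition push :: "('g \<Rightarrow> 'h) \<Rightarrow> ('g \<Rightarrow> complex) \<Rightarrow> 'h \<Rightarrow> complex" where
  "push \<phi> a = (\<lambda>y. \<Sum>x\<in>{x\<in>supp a. \<phi> x = y}. a x)"

definition has_torsion :: "'g::group_add itself \<Rightarrow> bool" where
  "has_torsion _ \<longleftrightarrow> (\<exists>u::'g. u \<noteq> 0 \<and> (\<exists>n::nat. n > 0 \<and> (((+) u) ^^ n) 0 = 0))"

definition l2 :: "('g \<Rightarrow> complex) set" where
  "l2 = {x. (\<lambda>g. (cmod (x g))\<^sup>2) summable_on UNIV}"

definition l2_inner :: "('g \<Rightarrow> complex) \<Rightarrow> ('g \<Rightarrow> complex) \<Rightarrow> complex" where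
  "l2_inner x y = (\<Sum>\<^sub>\<infinity>g. x g * cnj (y g))"

definition kernel_op :: "('g::group_add \<Rightarrow> complex) \<Rightarrow> ('g \<Rightarrow> complex) set" where
  "kernel_op a = {x \<in> l2. conv a x = (\<lambda>_. 0)}"

definition orth_proj :: "('g \<Rightarrow> complex) set \<Rightarrow> ('g \<Rightarrow> complex) \<Rightarrow> 'g \<Rightarrow> complex" where
  "orth_proj K x = (THE p. p \<in> K \<and> (\<forall>k\<in>K. l2_inner (\<lambda>g. x g - p g) k = 0))"

text \<open>dim_G K = tr_G(P_K) = < P_K(1), 1 >.\<close>
definition vn_dim :: "('g::group_add \<Rightarrow> complex) set \<Rightarrow> complex" where
  "vn_dim K = l2_inner (orth_proj K (delta 0)) (delta 0)"

end

theory Submission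
  imports Defs "HOL-Library.Poly_Mapping"
begin

text \<open>Write \<open>f j = t\<^sup>-\<^sup>j e t\<^sup>j\<close>; these are commuting projections that live in different copies of \<open>U\<close>.
For \<open>m \<ge> 1\<close> the projection \<open>(1 - f 1) f 2 \<dots> f m (1 - f (m + 1))\<close> and its translates under
\<open>t, \<dots>, t\<^sup>m\<close> form the diagonal of a system of \<open>m \<times> m\<close> matrix units in \<open>\<complex>[U \<wr> \<int>]\<close> on which \<open>T\<close> acts as
the adjacency matrix of a path with \<open>m\<close> vertices; the systems for different \<open>m\<close> are orthogonal.
The sine eigenvectors of the path split each system into projections \<open>E m k\<close>, \<open>1 \<le> k \<le> m\<close>, of trace
\<open>(1 - \<alpha>)\<^sup>2 \<alpha>\<^sup>m\<^sup>-\<^sup>1\<close> with \<open>\<alpha> = tr e\<close>, on which \<open>T\<close> is the scalar \<open>2 cos (\<pi>k/(m+1))\<close>, and all these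
traces add up to 1.  Hence \<open>l\<^sup>2(G)\<close> is the orthogonal sum of the ranges of \<open>E m k \<otimes> E' n l\<close>, the kernel
of \<open>T - S\<close> is the sum of those with \<open>k/(m+1) = l/(n+1)\<close>, and there are \<open>gcd (m+1) (n+1) - 1\<close> such
pairs \<open>(k, l)\<close> for given \<open>m\<close> and \<open>n\<close>.\<close>

text \<open>The binder of \<open>Sum_any\<close> is ambiguous with that of \<open>suminf\<close>.\<close>
no_syntax
  "_Sum_any" :: "pttrn \<Rightarrow> 'a \<Rightarrow> 'a::comm_monoid_add"
    (\<open>(\<open>indent=2 notation=\<open>binder \<Sum>\<close>\<close>\<Sum>_. _)\<close> [0, 10] 10)

section \<open>The complex group ring\<close>

abbreviation coef :: "('g \<Rightarrow>\<^sub>0 complex) \<Rightarrow> 'g \<Rightarrow> complex" where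
  "coef \<equiv> Poly_Mapping.lookup"

abbreviation single :: "'g \<Rightarrow> complex \<Rightarrow> 'g \<Rightarrow>\<^sub>0 complex" where
  "single \<equiv> Poly_Mapping.single"

abbreviation keys :: "('g \<Rightarrow>\<^sub>0 complex) \<Rightarrow> 'g set" where
  "keys \<equiv> Poly_Mapping.keys"

lemma supp_coef: "supp (coef a) = keys a"
  by (auto simp: supp_def in_keys_iff)

lemma coef_of_group_ring:
  assumes "p \<in> group_ring"
  obtains a where "p = coef a"
  using assms by (metis group_ring_def mem_Collect_eq supp_def lookup_Abs_poly_mapping)

lemma poly_mapping_sum_single: "a = (\<Sum>g\<in>keys a. single g (coef a g))"
proof (rule poly_mapping_eqI)
  fix k
  have "(\<Sum>g\<in>keys a. coef (single g (coef a g)) k) = (\<Sum>g\<in>keys a. if g = k then coef a g else 0)"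
    by (rule sum.cong) (auto simp: lookup_single)
  then show "coef a k = coef (\<Sum>g\<in>keys a. single g (coef a g)) k"
    by (simp add: lookup_sum in_keys_iff)
qed

lemma poly_mapping_add_induct [case_names single add]:
  assumes "\<And>g c. P (single g c)" and "\<And>a b. P a \<Longrightarrow> P b \<Longrightarrow> P (a + b)"
  shows "P (a :: 'g \<Rightarrow>\<^sub>0 complex)"
proof -
  have "P (\<Sum>g\<in>A. single g (coef a g))" if "finite A" for A
    using that
  proof induction
    case empty
    show ?case using assms(1)[of undefined 0] by simp
  qed (simp add: assms)
  then show ?thesis
    using poly_mapping_sum_single[of a] by (metis finite_keys)
qed

text \<open>Cancellation can make the support of a sum smaller than the union of the supports;
  summing over a common finite set makes additivity of \<open>conv\<close> immediate.\<close>

lemma conv_coef_superset: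
  assumes "finite S" "keys a \<subseteq> S"
  shows "conv (coef a) k x = (\<Sum>y\<in>S. coef a y * k (- y + x))"
  unfolding conv_def supp_coef
  by (rule sum.mono_neutral_left) (use assms in \<open>auto simp: in_keys_iff\<close>)

lemma conv_coef_add: "conv (coef (a + b)) k x = conv (coef a) k x + conv (coef b) k x"
proof -
  let ?S = "keys a \<union> keys b"
  have "keys (a + b) \<subseteq> ?S" by (rule keys_add)
  then show ?thesis
    by (simp add: conv_coef_superset[of ?S] lookup_add distrib_right sum.distrib)
qed

lemma conv_coef_single: "conv (coef (single g c)) k x = c * k (- g + x)"
  by (subst conv_coef_superset[of "{g}"]) auto

lemma conv_fun_diff: "conv a (\<lambda>x. k x - l x) y = conv a k y - conv a l y"
  by (simp add: conv_def right_diff_distrib sum_subtractf)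

text \<open>Here \<open>k\<close> may be any function, so elements of \<open>l2\<close> are covered
  as well. Both sides are additive in \<open>a\<close> and \<open>b\<close>, which leaves the case
  of two group elements.\<close>

lemma conv_mult: "conv (coef (a * b)) k x = conv (coef a) (conv (coef b) k) x"
proof (induction a arbitrary: x rule: poly_mapping_add_induct)
  case (single g c)
  show ?case
  proof (induction b arbitrary: x rule: poly_mapping_add_induct)
    case (single h d)
    show ?case
      by (simp add: mult_single conv_coef_single minus_add add.assoc del: add_uminus_conv_diff)
  next
    case (add a b)
    then show ?case
      by (simp add: distrib_left conv_coef_add conv_coef_single algebra_simps)
  qed
next
  case (add a b)
  then show ?case by (simp add: distrib_right conv_coef_add)
qed

lemma conv_delta_0: "conv (coef a) (delta 0) = coef a"
proof
  fix x
  have "conv (coef a) (delta 0) x = (\<Sum>y\<in>keys a. if y = x then coef a y else 0)"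
    unfolding conv_def supp_coef delta_def
    by (rule sum.cong) (auto simp: neg_eq_iff_add_eq_0[symmetric])
  then show "conv (coef a) (delta 0) x = coef a x" by (simp add: in_keys_iff)
qed

lemma coef_mult: "coef (a * b) = conv (coef a) (coef b)"
proof
  fix x
  have "coef (a * b) x = conv (coef a) (conv (coef b) (delta 0)) x"
    by (metis conv_mult conv_delta_0)
  then show "coef (a * b) x = conv (coef a) (coef b) x" by (simp add: conv_delta_0)
qed

lemma coef_single_mult:
  fixes a :: "'g::group_add \<Rightarrow>\<^sub>0 complex"
  shows "coef (single g c * a) x = c * coef a (- g + x)"
  by (simp add: coef_mult conv_coef_single)

lemma coef_mult_single:
  fixes a :: "'g::group_add \<Rightarrow>\<^sub>0 complex"
  shows "coef (a * single g c) x = coef a (x - g) * c"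
proof (induction a rule: poly_mapping_add_induct)
  case (single h d)
  show ?case by (auto simp: mult_single lookup_single when_def algebra_simps)
next
  case (add a b)
  then show ?case by (simp add: distrib_right lookup_add)
qed

lemma single_zero_mult_commute:
  fixes a :: "'g::group_add \<Rightarrow>\<^sub>0 complex"
  shows "a * single 0 c = single 0 c * a"
  by (rule poly_mapping_eqI) (simp add: coef_mult_single coef_single_mult)

section \<open>The involution of the group ring\<close>

definition star :: "('g::group_add \<Rightarrow>\<^sub>0 complex) \<Rightarrow> 'g \<Rightarrow>\<^sub>0 complex" where
  "star a = Abs_poly_mapping (gstar (coef a))"

lemma coef_star: "coef (star a) x = cnj (coef a (- x))"
proof -
  have "{x. gstar (coef a) x \<noteq> 0} = uminus ` keys a"
    by (auto simp: gstar_def in_keys_iff image_iff intro!: bexI[of _ "- _"])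
  then have "finite {x. gstar (coef a) x \<noteq> 0}" by simp
  then show ?thesis by (simp add: star_def gstar_def)
qed

lemma star_add [simp]: "star (a + b) = star a + star b"
  by (rule poly_mapping_eqI) (simp add: coef_star lookup_add)

lemma star_diff [simp]: "star (a - b) = star a - star b"
  by (rule poly_mapping_eqI) (simp add: coef_star lookup_minus)

lemma star_single [simp]: "star (single g c) = single (- g) (cnj c)"
  by (rule poly_mapping_eqI) (auto simp: coef_star lookup_single when_def)

lemma star_zero [simp]: "star 0 = 0"
  by (rule poly_mapping_eqI) (simp add: coef_star)

lemma star_one [simp]: "star 1 = 1"
  using star_single[of 0 1] by simp

lemma star_mult [simp]: "star (a * b) = star b * star a"
proof (induction a rule: poly_mapping_add_induct)
  case (single g c)
  show ?case
    by (rule poly_mapping_eqI)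
      (simp add: coef_star coef_single_mult coef_mult_single minus_add)
next
  case (add a b)
  then show ?case by (simp add: distrib_left distrib_right)
qed

lemma star_sum [simp]: "star (sum f A) = (\<Sum>i\<in>A. star (f i))"
  by (induction A rule: infinite_finite_induct) auto

section \<open>Maps of group rings induced by maps of groups\<close>

definition push_alg :: "('g \<Rightarrow> 'h) \<Rightarrow> ('g \<Rightarrow>\<^sub>0 complex) \<Rightarrow> 'h \<Rightarrow>\<^sub>0 complex" where
  "push_alg \<phi> a = (\<Sum>x\<in>keys a. single (\<phi> x) (coef a x))"

lemma coef_push_alg: "coef (push_alg \<phi> a) = push \<phi> (coef a)"
  by (rule ext) (auto simp: push_alg_def push_def supp_coef lookup_sum lookup_single when_def
      sum.If_cases Int_def)

lemma coef_push_alg_inj: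
  assumes "inj \<phi>"
  shows "coef (push_alg \<phi> a) (\<phi> x) = coef a x"
proof -
  have "{z \<in> supp (coef a). \<phi> z = \<phi> x} = (if x \<in> keys a then {x} else {})"
    using assms by (auto simp: inj_eq supp_coef)
  then show ?thesis by (simp add: coef_push_alg push_def in_keys_iff)
qed

lemma keys_push_alg: "keys (push_alg \<phi> a) \<subseteq> \<phi> ` keys a"
  unfolding push_alg_def by (rule order_trans[OF keys_sum]) auto

lemma push_alg_superset:
  assumes "finite S" "keys a \<subseteq> S"
  shows "push_alg \<phi> a = (\<Sum>x\<in>S. single (\<phi> x) (coef a x))"
  unfolding push_alg_def
  by (rule sum.mono_neutral_left) (use assms in \<open>auto simp: in_keys_iff\<close>)

lemma push_alg_single [simp]: "push_alg \<phi> (single g c) = single (\<phi> g) c"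
  by (subst push_alg_superset[of "{g}"]) auto

lemma push_alg_add [simp]: "push_alg \<phi> (a + b) = push_alg \<phi> a + push_alg \<phi> b"
proof -
  let ?S = "keys a \<union> keys b"
  have "keys (a + b) \<subseteq> ?S" by (rule keys_add)
  then show ?thesis
    by (simp add: push_alg_superset[of ?S] lookup_add single_add sum.distrib)
qed

lemma push_alg_one: "\<phi> 0 = 0 \<Longrightarrow> push_alg \<phi> 1 = 1"
  using push_alg_single[of \<phi> 0 1] by simp

lemma push_alg_zero [simp]: "push_alg \<phi> 0 = 0"
  by (simp add: push_alg_def)

lemma push_alg_mult:
  fixes \<phi> :: "'g::group_add \<Rightarrow> 'h::group_add"
  assumes "\<And>x y. \<phi> (x + y) = \<phi> x + \<phi> y"
  shows "push_alg \<phi> (a * b) = push_alg \<phi> a * push_alg \<phi> b"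
proof (induction a rule: poly_mapping_add_induct)
  case (single g c)
  show ?case
  proof (induction b rule: poly_mapping_add_induct)
    case (single h d)
    show ?case by (simp add: mult_single assms)
  next
    case (add a b)
    then show ?case by (simp add: distrib_left)
  qed
next
  case (add a b)
  then show ?case by (simp add: distrib_right)
qed

lemma push_alg_star:
  fixes \<phi> :: "'g::group_add \<Rightarrow> 'h::group_add"
  assumes "\<And>x. \<phi> (- x) = - \<phi> x"
  shows "star (push_alg \<phi> a) = push_alg \<phi> (star a)"
  by (induction a rule: poly_mapping_add_induct) (simp_all add: assms)

text \<open>This serves both for copies of a group at different positions of the wreath product and
  for the two factors of a direct product.\<close>

lemma push_alg_commute:
  fixes \<phi> :: "'g \<Rightarrow> 'k::group_add" and \<psi> :: "'h \<Rightarrow> 'k"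
  assumes "\<And>x y. \<phi> x + \<psi> y = \<psi> y + \<phi> x"
  shows "push_alg \<phi> a * push_alg \<psi> b = push_alg \<psi> b * push_alg \<phi> a"
proof (induction a rule: poly_mapping_add_induct)
  case (single g c)
  show ?case
    by (induction b rule: poly_mapping_add_induct)
      (simp_all add: mult_single assms distrib_left distrib_right mult.commute)
next
  case (add a b)
  then show ?case by (simp add: distrib_left distrib_right)
qed

text \<open>A term of the convolution at \<open>0\<close> pairs \<open>x\<close> with
  \<open>- x\<close>, and the hypothesis leaves only \<open>x = 0\<close>. The product formulas for
  traces below rest on this.\<close>

lemma coef_mult_zero_disjoint:
  fixes a b :: "'g::group_add \<Rightarrow>\<^sub>0 complex"
  assumes "\<And>x. x \<in> keys a \<Longrightarrow> - x \<in> keys b \<Longrightarrow> x = 0"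
  shows "coef (a * b) 0 = coef a 0 * coef b 0"
proof -
  have "coef (a * b) 0 = (\<Sum>y\<in>insert 0 (keys a). coef a y * coef b (- y + 0))"
    unfolding coef_mult by (rule conv_coef_superset) auto
  also have "\<dots> = (\<Sum>y\<in>{0}. coef a y * coef b (- y + 0))"
    by (rule sum.mono_neutral_right) (use assms in \<open>auto simp: in_keys_iff\<close>)
  finally show ?thesis by simp
qed

section \<open>Projections and their traces\<close>

lemma sum_norm_coef: "coef (a * star a) 0 = of_real (\<Sum>x\<in>keys a. (cmod (coef a x))\<^sup>2)"
  by (simp add: coef_mult conv_def supp_coef coef_star complex_norm_square del: of_real_power)

definition projection :: "('g::group_add \<Rightarrow>\<^sub>0 complex) \<Rightarrow> bool" where
  "projection p \<longleftrightarrow> star p = p \<and> p * p = p"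

lemma projection_sum_norm:
  assumes "projection p"
  shows "coef p 0 = of_real (\<Sum>x\<in>keys p. (cmod (coef p x))\<^sup>2)"
  using sum_norm_coef[of p] assms by (simp add: projection_def)

lemma projection_trace_real:
  assumes "projection p"
  shows "coef p 0 = of_real (Re (coef p 0))"
  using projection_sum_norm[OF assms] by simp

lemma projection_trace_nonneg:
  assumes "projection p"
  shows "0 \<le> Re (coef p 0)"
  using projection_sum_norm[OF assms] by (simp add: sum_nonneg)

text \<open>Faithfulness of the trace: on a projection it is the squared l2 norm.\<close>

lemma projection_trace_pos:
  assumes "projection p" "p \<noteq> 0"
  shows "0 < Re (coef p 0)"
proof -
  have "keys p \<noteq> {}" using assms(2) by simp
  then show ?thesis
    by (simp add: projection_sum_norm[OF assms(1)], intro sum_pos) (auto simp: in_keys_iff)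
qed

lemma projection_one_minus: "projection p \<Longrightarrow> projection (1 - p)"
  by (simp add: projection_def algebra_simps)

lemma projection_sum_norm_le:
  assumes "projection p" "finite B"
  shows "(\<Sum>x\<in>B. (cmod (coef p x))\<^sup>2) \<le> Re (coef p 0)"
proof -
  have "(\<Sum>x\<in>B. (cmod (coef p x))\<^sup>2) \<le> (\<Sum>x\<in>B \<union> keys p. (cmod (coef p x))\<^sup>2)"
    by (rule sum_mono2) (use assms in auto)
  also have "\<dots> = (\<Sum>x\<in>keys p. (cmod (coef p x))\<^sup>2)"
    by (rule sum.mono_neutral_right) (use assms in \<open>auto simp: in_keys_iff\<close>)
  also have "\<dots> = Re (coef p 0)"
    using projection_sum_norm[OF assms(1)] by simp
  finally show ?thesis .
qed

text \<open>Cauchy-Schwarz for the convolution \<open>p * p = p\<close>, both factors having squared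
  norm at most the trace. The bound turns summable traces into absolute convergence of each
  coefficient of a sum of projections.\<close>

lemma projection_cmod_le:
  assumes "projection p"
  shows "cmod (coef p x) \<le> Re (coef p 0)"
proof -
  have "coef p x = (\<Sum>y\<in>keys p. coef p y * coef p (- y + x))"
    using assms by (metis projection_def coef_mult conv_def supp_coef)
  then have "cmod (coef p x) \<le> (\<Sum>y\<in>keys p. cmod (coef p y) * cmod (coef p (- y + x)))"
    by (metis (no_types, lifting) norm_sum norm_mult sum.cong)
  also have "\<dots> \<le> sqrt (\<Sum>y\<in>keys p. (cmod (coef p y))\<^sup>2) * sqrt (\<Sum>y\<in>keys p. (cmod (coef p (- y + x)))\<^sup>2)"
    using L2_set_mult_ineq[of "\<lambda>y. cmod (coef p y)" "\<lambda>y. cmod (coef p (- y + x))" "keys p"]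
    by (simp add: L2_set_def)
  also have "(\<Sum>y\<in>keys p. (cmod (coef p (- y + x)))\<^sup>2) = (\<Sum>z\<in>(\<lambda>y. - y + x) ` keys p. (cmod (coef p z))\<^sup>2)"
    by (subst sum.reindex) (auto simp: inj_on_def)
  also have "sqrt (\<Sum>y\<in>keys p. (cmod (coef p y))\<^sup>2) * sqrt \<dots> \<le> sqrt (Re (coef p 0)) * sqrt (Re (coef p 0))"
    using assms by (intro mult_mono real_sqrt_le_mono projection_sum_norm_le) (auto simp: projection_trace_nonneg sum_nonneg)
  finally show ?thesis using projection_trace_nonneg[OF assms] by simp
qed

text \<open>For self-adjoint \<open>a\<close> this is \<open>\<langle>a k, \<delta>\<^sub>0\<rangle> = \<langle>k, a \<delta>\<^sub>0\<rangle>\<close>, for an arbitrary function \<open>k\<close>.\<close>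
lemma conv_zero_self_adjoint:
  assumes "star a = a"
  shows "conv (coef a) k 0 = (\<Sum>y\<in>keys a. k y * cnj (coef a y))"
proof -
  have *: "coef a (- y) = cnj (coef a y)" for y
    using coef_star[of a "- y"] assms by simp
  have "keys a = uminus ` keys a"
  proof -
    have "- y \<in> keys a" if "y \<in> keys a" for y using that * by (simp add: in_keys_iff)
    then show ?thesis by (auto simp: image_iff intro!: bexI[of _ "- _"])
  qed
  then have "conv (coef a) k 0 = (\<Sum>y\<in>uminus ` keys a. coef a y * k (- y + 0))"
    by (simp add: conv_def supp_coef)
  also have "\<dots> = (\<Sum>y\<in>keys a. k y * cnj (coef a y))"
    by (subst sum.reindex) (auto simp: inj_on_def * mult.commute)
  finally show ?thesis .
qed

lemma nontrivial_projectionE: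
  assumes "nontrivial_projection e"
  obtains p where "e = coef p" "projection p" "p \<noteq> 0" "p \<noteq> 1"
proof -
  obtain p where p: "e = coef p"
    using assms coef_of_group_ring unfolding nontrivial_projection_def by blast
  have "star p = p"
    using assms
    by (intro poly_mapping_eqI) (simp add: p nontrivial_projection_def coef_star gstar_def fun_eq_iff)
  moreover have "p * p = p"
    using assms by (intro poly_mapping_eqI) (simp add: p nontrivial_projection_def coef_mult)
  moreover have "p \<noteq> 0" "p \<noteq> 1"
    using assms by (auto simp: p nontrivial_projection_def fun_eq_iff delta_def lookup_one when_def)
  ultimately show ?thesis using that p by (simp add: projection_def)
qed

text \<open>Real multiples are written as multiplication by a central element, so that the ring laws
  cover them.\<close>

definition scal :: "real \<Rightarrow> 'g::group_add \<Rightarrow>\<^sub>0 complex" where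
  "scal c = single 0 (of_real c)"

lemma scal_add: "scal (c + d) = scal c + scal d"
  by (simp add: scal_def single_add)

lemma scal_mult: "scal (c * d) = scal c * scal d"
  by (simp add: scal_def mult_single)

lemma scal_zero [simp]: "scal 0 = 0"
  by (simp add: scal_def)

lemma scal_sum: "scal (sum c A) = (\<Sum>i\<in>A. scal (c i))"
  by (induction A rule: infinite_finite_induct) (auto simp: scal_add)

lemma star_scal [simp]: "star (scal c) = scal c"
  by (simp add: scal_def)

lemma scal_commute: "a * scal c = scal c * a"
  unfolding scal_def by (rule single_zero_mult_commute)

lemma mult_scal_mult: "a * (scal c * b) = scal c * (a * b)"
  by (metis mult.assoc scal_commute)

lemma scal_mult_scal_mult: "(scal c * a) * (scal d * b) = scal (c * d) * (a * b)"
  unfolding mult.assoc mult_scal_mult[of a] scal_mult ..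

lemma coef_scal_mult: "coef (scal c * a) x = of_real c * coef a x"
  by (simp add: scal_def coef_single_mult)

section \<open>Kernels with a complete system of eigenprojections\<close>

text \<open>The squared l2 norm is at most \<open>s\<close>, expressed through finite partial sums:
  such bounds pass to pointwise limits with no prior knowledge of summability.\<close>

definition l2_le :: "('g \<Rightarrow> complex) \<Rightarrow> real \<Rightarrow> bool" where
  "l2_le x s \<longleftrightarrow> (\<forall>B. finite B \<longrightarrow> (\<Sum>g\<in>B. (cmod (x g))\<^sup>2) \<le> s)"

lemma l2_iff: "x \<in> l2 \<longleftrightarrow> (\<exists>s. l2_le x s)"
proof
  assume "x \<in> l2"
  then have "l2_le x (\<Sum>\<^sub>\<infinity>g. (cmod (x g))\<^sup>2)"
    by (auto simp: l2_le_def l2_def intro!: finite_sum_le_infsum)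
  then show "\<exists>s. l2_le x s" ..
next
  assume "\<exists>s. l2_le x s"
  then obtain s where "l2_le x s" ..
  then show "x \<in> l2"
    by (auto simp: l2_def l2_le_def intro!: nonneg_bdd_above_summable_on bdd_aboveI[of _ s])
qed

lemma l2_le_nonneg: "l2_le x s \<Longrightarrow> 0 \<le> s"
  by (auto simp: l2_le_def dest: spec[of _ "{}"])

lemma l2_le_add:
  assumes "l2_le x s" "l2_le y r"
  shows "l2_le (\<lambda>g. x g + y g) (2 * s + 2 * r)"
  unfolding l2_le_def
proof (intro allI impI)
  fix B :: "'a set"
  assume B: "finite B"
  have "(cmod (x g + y g))\<^sup>2 \<le> 2 * (cmod (x g))\<^sup>2 + 2 * (cmod (y g))\<^sup>2" for g
  proof -
    have "(cmod (x g + y g))\<^sup>2 \<le> (cmod (x g) + cmod (y g))\<^sup>2"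
      by (rule power_mono[OF norm_triangle_ineq]) simp
    then show ?thesis
      using zero_le_power2[of "cmod (x g) - cmod (y g)"]
      unfolding power2_sum power2_diff by linarith
  qed
  then have "(\<Sum>g\<in>B. (cmod (x g + y g))\<^sup>2)
      \<le> (\<Sum>g\<in>B. 2 * (cmod (x g))\<^sup>2 + 2 * (cmod (y g))\<^sup>2)"
    by (rule sum_mono)
  also have "\<dots> = 2 * (\<Sum>g\<in>B. (cmod (x g))\<^sup>2) + 2 * (\<Sum>g\<in>B. (cmod (y g))\<^sup>2)"
    by (simp add: sum.distrib sum_distrib_left)
  also have "\<dots> \<le> 2 * s + 2 * r"
    using assms B by (auto simp: l2_le_def intro!: add_mono)
  finally show "(\<Sum>g\<in>B. (cmod (x g + y g))\<^sup>2) \<le> 2 * s + 2 * r" .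
qed

lemma l2_diff:
  assumes "x \<in> l2" "y \<in> l2"
  shows "(\<lambda>g. x g - y g) \<in> l2"
proof -
  from assms obtain s r where "l2_le x s" "l2_le y r" unfolding l2_iff by blast
  then have "l2_le (\<lambda>g. x g + - y g) (2 * s + 2 * r)"
    by (intro l2_le_add) (simp_all add: l2_le_def)
  then show ?thesis unfolding l2_iff by auto
qed

lemma l2_le_projection: "projection p \<Longrightarrow> l2_le (coef p) (Re (coef p 0))"
  by (simp add: l2_le_def projection_sum_norm_le)

text \<open>Cauchy-Schwarz on every finite set, then the passage to the infinite sum.\<close>

lemma l2_inner_bound:
  assumes "l2_le x s" "l2_le y r"
  shows "(\<lambda>g. norm (x g * cnj (y g))) summable_on UNIV"
    and "cmod (l2_inner x y) \<le> sqrt s * sqrt r"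
proof -
  have *: "(\<Sum>g\<in>B. norm (x g * cnj (y g))) \<le> sqrt s * sqrt r" if "finite B" for B
  proof -
    have "(\<Sum>g\<in>B. norm (x g * cnj (y g))) \<le> sqrt (\<Sum>g\<in>B. (cmod (x g))\<^sup>2) * sqrt (\<Sum>g\<in>B. (cmod (y g))\<^sup>2)"
      using L2_set_mult_ineq[of "\<lambda>g. cmod (x g)" "\<lambda>g. cmod (y g)" B]
      by (simp add: L2_set_def norm_mult)
    also have "\<dots> \<le> sqrt s * sqrt r"
      using assms that l2_le_nonneg[OF assms(1)]
      by (intro mult_mono real_sqrt_le_mono) (auto simp: l2_le_def sum_nonneg)
    finally show ?thesis .
  qed
  show summ: "(\<lambda>g. norm (x g * cnj (y g))) summable_on UNIV"
    by (rule nonneg_bdd_above_summable_on) (use * in \<open>auto intro!: bdd_aboveI[of _ "sqrt s * sqrt r"]\<close>)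
  have "cmod (l2_inner x y) \<le> (\<Sum>\<^sub>\<infinity>g. norm (x g * cnj (y g)))"
    unfolding l2_inner_def by (rule norm_infsum_bound[OF summ])
  also have "\<dots> \<le> sqrt s * sqrt r"
    by (rule infsum_le_finite_sums[OF summ]) (use * in auto)
  finally show "cmod (l2_inner x y) \<le> sqrt s * sqrt r" .
qed

lemma l2_inner_summable:
  assumes "x \<in> l2" "y \<in> l2"
  shows "(\<lambda>g. x g * cnj (y g)) summable_on UNIV"
proof -
  from assms obtain s r where "l2_le x s" "l2_le y r" unfolding l2_iff by blast
  from l2_inner_bound(1)[OF this] show ?thesis by (rule abs_summable_summable)
qed

lemma l2_inner_diff_left:
  assumes "x \<in> l2" "y \<in> l2" "k \<in> l2"
  shows "l2_inner (\<lambda>g. x g - y g) k = l2_inner x k - l2_inner y k"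
proof -
  have "l2_inner (\<lambda>g. x g - y g) k = (\<Sum>\<^sub>\<infinity>g. x g * cnj (k g) + - (y g * cnj (k g)))"
    by (simp add: l2_inner_def left_diff_distrib)
  also have "\<dots> = l2_inner x k + (\<Sum>\<^sub>\<infinity>g. - (y g * cnj (k g)))"
    unfolding l2_inner_def
    by (rule infsum_add) (use assms in \<open>auto intro!: l2_inner_summable summable_on_uminus[THEN iffD2]\<close>)
  finally show ?thesis by (simp add: l2_inner_def infsum_uminus)
qed

lemma l2_inner_self_eq_0:
  assumes "x \<in> l2" "l2_inner x x = 0"
  shows "x g = 0"
proof -
  have "l2_inner x x = (\<Sum>\<^sub>\<infinity>g. of_real ((cmod (x g))\<^sup>2))"
    by (simp add: l2_inner_def complex_norm_square del: of_real_power)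
  also have "\<dots> = of_real (\<Sum>\<^sub>\<infinity>g. (cmod (x g))\<^sup>2)"
    using assms(1) by (intro infsumI has_sum_of_real has_sum_infsum) (simp add: l2_def)
  finally have "(\<Sum>\<^sub>\<infinity>g. (cmod (x g))\<^sup>2) = 0" using assms(2) by simp
  then have "(cmod (x g))\<^sup>2 = 0"
    using assms(1) by (intro nonneg_infsum_le_0D[of "\<lambda>g. (cmod (x g))\<^sup>2" UNIV]) (auto simp: l2_def)
  then show ?thesis by simp
qed

lemma l2_inner_coef: "l2_inner (coef a) k = (\<Sum>g\<in>keys a. coef a g * cnj (k g))"
proof -
  have "l2_inner (coef a) k = (\<Sum>\<^sub>\<infinity>g\<in>keys a. coef a g * cnj (k g))"
    unfolding l2_inner_def by (rule infsum_cong_neutral) (auto simp: in_keys_iff)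
  then show ?thesis by simp
qed

lemma l2_inner_delta: "l2_inner x (delta g) = x g"
proof -
  have "l2_inner x (delta g) = (\<Sum>\<^sub>\<infinity>h\<in>{g}. x h * cnj (delta g h))"
    unfolding l2_inner_def by (rule infsum_cong_neutral) (auto simp: delta_def)
  then show ?thesis by (simp add: delta_def)
qed

lemma coef_in_l2: "coef a \<in> l2"
proof -
  have "l2_le (coef a) (\<Sum>g\<in>keys a. (cmod (coef a g))\<^sup>2)"
    unfolding l2_le_def
  proof (intro allI impI)
    fix B :: "'a set" assume B: "finite B"
    have "(\<Sum>g\<in>B. (cmod (coef a g))\<^sup>2) = (\<Sum>g\<in>B \<inter> keys a. (cmod (coef a g))\<^sup>2)"
      by (rule sum.mono_neutral_right) (use B in \<open>auto simp: in_keys_iff\<close>)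
    also have "\<dots> \<le> (\<Sum>g\<in>keys a. (cmod (coef a g))\<^sup>2)"
      by (rule sum_mono2) auto
    finally show "(\<Sum>g\<in>B. (cmod (coef a g))\<^sup>2) \<le> (\<Sum>g\<in>keys a. (cmod (coef a g))\<^sup>2)" .
  qed
  then show ?thesis unfolding l2_iff ..
qed

lemma delta_eq_coef: "delta g = coef (single g 1)"
  by (auto simp: delta_def lookup_single)

section \<open>Orthogonal projection onto a kernel\<close>

lemma kernel_op_diff:
  assumes "x \<in> kernel_op a" "y \<in> kernel_op a"
  shows "(\<lambda>g. x g - y g) \<in> kernel_op a"
  using assms by (auto simp: kernel_op_def l2_diff fun_eq_iff conv_fun_diff)

text \<open>Two candidates differ by an element of the kernel that is orthogonal to the kernel,
  hence to itself. This is the uniqueness that \<open>THE\<close> requires; existence is witnessed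
  by \<open>p\<close>.\<close>

lemma orth_proj_eqI:
  assumes p: "p \<in> kernel_op a" and ortho: "\<And>k. k \<in> kernel_op a \<Longrightarrow> l2_inner (\<lambda>g. x g - p g) k = 0"
    and x: "x \<in> l2"
  shows "orth_proj (kernel_op a) x = p"
  unfolding orth_proj_def
proof (rule the_equality)
  show "p \<in> kernel_op a \<and> (\<forall>k\<in>kernel_op a. l2_inner (\<lambda>g. x g - p g) k = 0)"
    using p ortho by blast
next
  fix q
  assume q: "q \<in> kernel_op a \<and> (\<forall>k\<in>kernel_op a. l2_inner (\<lambda>g. x g - q g) k = 0)"
  let ?w = "\<lambda>g. p g - q g"
  have w: "?w \<in> kernel_op a" using p q kernel_op_diff by blast
  have l2: "p \<in> l2" "q \<in> l2" "?w \<in> l2" using p q w by (auto simp: kernel_op_def)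
  have "l2_inner ?w ?w = l2_inner (\<lambda>g. (x g - q g) - (x g - p g)) ?w" by simp
  also have "\<dots> = l2_inner (\<lambda>g. x g - q g) ?w - l2_inner (\<lambda>g. x g - p g) ?w"
    by (rule l2_inner_diff_left) (use l2 x in \<open>auto intro: l2_diff\<close>)
  also have "\<dots> = 0" using q w ortho by simp
  finally have "?w g = 0" for g by (rule l2_inner_self_eq_0[OF l2(3)])
  then show "q = p" by (auto simp: fun_eq_iff)
qed

lemma projection_sum:
  assumes "finite F" "\<And>i. i \<in> F \<Longrightarrow> projection (E i)"
    and "\<And>i j. i \<in> F \<Longrightarrow> j \<in> F \<Longrightarrow> i \<noteq> j \<Longrightarrow> E i * E j = 0"
  shows "projection (\<Sum>i\<in>F. E i)"
proof -
  have "(\<Sum>i\<in>F. E i) * (\<Sum>i\<in>F. E i) = (\<Sum>i\<in>F. \<Sum>j\<in>F. E i * E j)"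
    by (rule sum_product)
  also have "\<dots> = (\<Sum>i\<in>F. \<Sum>j\<in>F. if i = j then E i else 0)"
    using assms by (intro sum.cong) (auto simp: projection_def)
  also have "\<dots> = (\<Sum>i\<in>F. E i)" using assms(1) by simp
  finally show ?thesis using assms(2) by (simp add: projection_def)
qed

text \<open>The projection of \<open>delta 0\<close> onto the kernel is the sum \<open>p\<close> of
  the \<open>E i\<close> with eigenvalue 0. The other \<open>E i\<close> annihilate the kernel,
  because \<open>E i * a\<close> is a nonzero multiple of \<open>E i\<close>. Since the traces add
  up to 1, the finite sums of the \<open>E i\<close> tend to \<open>delta 0\<close> in l2, so
  \<open>delta 0 - p\<close> is a limit of vectors orthogonal to the kernel.\<close>

theorem vn_dim_kernel_eigenprojections:
  fixes a :: "'g::group_add \<Rightarrow>\<^sub>0 complex" and E :: "'i \<Rightarrow> 'g \<Rightarrow>\<^sub>0 complex"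
  assumes self_adjoint: "star a = a"
    and proj: "\<And>i. i \<in> I \<Longrightarrow> projection (E i)"
    and orth: "\<And>i j. i \<in> I \<Longrightarrow> j \<in> I \<Longrightarrow> i \<noteq> j \<Longrightarrow> E i * E j = 0"
    and eigen: "\<And>i. i \<in> I \<Longrightarrow> a * E i = single 0 (of_real (\<mu> i)) * E i"
    and total: "((\<lambda>i. Re (coef (E i) 0)) has_sum 1) I"
  shows "vn_dim (kernel_op (coef a)) = (\<Sum>\<^sub>\<infinity>i\<in>{i\<in>I. \<mu> i = 0}. coef (E i) 0)"
proof -
  define \<tau> where "\<tau> i = Re (coef (E i) 0)" for i
  define I0 where "I0 = {i\<in>I. \<mu> i = 0}"
  define P where "P F = (\<Sum>i\<in>F. E i)" for F
  define p where "p x = (\<Sum>\<^sub>\<infinity>i\<in>I0. coef (E i) x)" for x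
  have I0: "I0 \<subseteq> I" by (auto simp: I0_def)
  have tau_nonneg: "0 \<le> \<tau> i" if "i \<in> I" for i
    using that proj projection_trace_nonneg by (auto simp: \<tau>_def)
  have tau_sum: "\<tau> summable_on I" using total unfolding \<tau>_def by (rule has_sum_imp_summable)
  have tau_sum0: "\<tau> summable_on I0" using tau_sum I0 by (rule summable_on_subset)
  define t0 where "t0 = infsum \<tau> I0"
  have projP: "projection (P F)" if "finite F" "F \<subseteq> I" for F
    unfolding P_def using that by (intro projection_sum proj orth) auto
  have trP: "Re (coef (P F) 0) = sum \<tau> F" for F
    by (simp add: P_def \<tau>_def lookup_sum)
  have tau_le: "sum \<tau> F \<le> t0" if "finite F" "F \<subseteq> I0" for F
    unfolding t0_def using that tau_sum0 tau_nonneg I0 by (intro finite_sum_le_infsum) auto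
  have lim: "((\<lambda>F. coef (P F) x) \<longlongrightarrow> p x) (finite_subsets_at_top I0)" for x
  proof -
    have "(\<lambda>i. norm (coef (E i) x)) summable_on I0"
      by (rule Infinite_Sum.abs_summable_on_comparison_test'[OF tau_sum0])
        (use I0 proj in \<open>auto simp: \<tau>_def intro!: projection_cmod_le\<close>)
    then have "((\<lambda>i. coef (E i) x) has_sum p x) I0"
      unfolding p_def by (rule has_sum_infsum[OF abs_summable_summable])
    then show ?thesis by (simp add: has_sum_def P_def lookup_sum)
  qed
  \<comment> \<open>The pointwise limit is upgraded to l2: the difference of two partial sums is
    again a projection, \<open>P (F' - F)\<close>, whose squared norm is its trace and thus at most
    what \<open>F\<close> leaves of \<open>t0\<close>.\<close>
  have tail: "l2_le (\<lambda>x. p x - coef (P F) x) (t0 - sum \<tau> F)" if F: "finite F" "F \<subseteq> I0" for F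
    unfolding l2_le_def
  proof (intro allI impI)
    fix B :: "'g set"
    assume B: "finite B"
    show "(\<Sum>x\<in>B. (cmod (p x - coef (P F) x))\<^sup>2) \<le> t0 - sum \<tau> F"
    proof (rule tendsto_upperbound)
      show "((\<lambda>F'. \<Sum>x\<in>B. (cmod (coef (P F') x - coef (P F) x))\<^sup>2)
          \<longlongrightarrow> (\<Sum>x\<in>B. (cmod (p x - coef (P F) x))\<^sup>2)) (finite_subsets_at_top I0)"
        by (intro tendsto_intros lim)
      show "\<forall>\<^sub>F F' in finite_subsets_at_top I0.
          (\<Sum>x\<in>B. (cmod (coef (P F') x - coef (P F) x))\<^sup>2) \<le> t0 - sum \<tau> F"
        unfolding eventually_finite_subsets_at_top
      proof (intro exI conjI allI impI)
        fix F'
        assume F': "finite F' \<and> F \<subseteq> F' \<and> F' \<subseteq> I0"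
        have "coef (P F') x - coef (P F) x = coef (P (F' - F)) x" for x
          using F F' by (simp add: P_def sum_diff lookup_minus)
        then have "(\<Sum>x\<in>B. (cmod (coef (P F') x - coef (P F) x))\<^sup>2) \<le> Re (coef (P (F' - F)) 0)"
          using F' I0 B by (auto intro!: projection_sum_norm_le projP)
        also have "\<dots> = sum \<tau> F' - sum \<tau> F" using F F' by (simp add: trP sum_diff)
        also have "\<dots> \<le> t0 - sum \<tau> F" using tau_le F' by auto
        finally show "(\<Sum>x\<in>B. (cmod (coef (P F') x - coef (P F) x))\<^sup>2) \<le> t0 - sum \<tau> F" .
      qed (use F in auto)
    qed simp
  qed
  \<comment> \<open>Adjoints turn the left eigenvalue equation into the right one, as the eigenvalue
    is real and central.\<close>
  have eigen': "E i * a = single 0 (of_real (\<mu> i)) * E i" if "i \<in> I" for i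
  proof -
    have "E i * a = star (a * E i)"
      using self_adjoint proj[OF that] by (simp add: projection_def)
    also have "\<dots> = single 0 (of_real (\<mu> i)) * E i"
      using proj[OF that] by (simp add: eigen[OF that] projection_def single_zero_mult_commute)
    finally show ?thesis .
  qed
  have p_l2: "p \<in> l2"
    using tail[of "{}"] unfolding l2_iff by (auto simp: P_def)
  have p_kernel: "p \<in> kernel_op (coef a)"
  proof -
    have "conv (coef a) p x = 0" for x
    proof (rule tendsto_unique)
      \<comment> \<open>At each \<open>x\<close>, \<open>conv (coef a)\<close> is a finite sum, so
        pointwise convergence suffices.\<close>
      show "((\<lambda>F. conv (coef a) (coef (P F)) x) \<longlongrightarrow> conv (coef a) p x) (finite_subsets_at_top I0)"
        unfolding conv_def by (intro tendsto_intros lim)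
      have "conv (coef a) (coef (P F)) x = 0" if "F \<subseteq> I0" for F
      proof -
        have "a * P F = 0"
          unfolding P_def sum_distrib_left
          by (rule sum.neutral) (use that eigen in \<open>auto simp: I0_def\<close>)
        then show ?thesis by (simp add: coef_mult[symmetric])
      qed
      then have "\<forall>\<^sub>F F in finite_subsets_at_top I0. conv (coef a) (coef (P F)) x = 0"
        by (auto simp: eventually_finite_subsets_at_top)
      then show "((\<lambda>F. conv (coef a) (coef (P F)) x) \<longlongrightarrow> 0) (finite_subsets_at_top I0)"
        by (rule tendsto_eventually)
    qed simp
    then show ?thesis using p_l2 by (auto simp: kernel_op_def)
  qed
  have ortho: "l2_inner (\<lambda>g. delta 0 g - p g) k = 0" if k: "k \<in> kernel_op (coef a)" for k
  proof -
    have k_l2: "k \<in> l2" using k by (simp add: kernel_op_def)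
    then obtain r where r: "l2_le k r" unfolding l2_iff ..
    have E_k: "conv (coef (E i)) k 0 = 0" if i: "i \<in> I" "\<mu> i \<noteq> 0" for i
    proof -
      have "conv (coef (E i * a)) k 0 = conv (coef (E i)) (\<lambda>_. 0) 0"
        using k by (simp add: conv_mult kernel_op_def)
      moreover have "conv (coef (E i * a)) k 0 = of_real (\<mu> i) * conv (coef (E i)) k 0"
        by (simp add: eigen'[OF i(1)] conv_mult conv_coef_single)
      ultimately show ?thesis using i by (simp add: conv_def)
    qed
    have bound: "cmod (l2_inner (\<lambda>g. delta 0 g - p g) k) \<le> sqrt (4 * (1 - sum \<tau> F)) * sqrt r"
      if F: "finite F" "F \<subseteq> I" for F
    proof -
      let ?F0 = "F \<inter> I0"
      \<comment> \<open>The part \<open>c\<close> of \<open>P F\<close> with nonzero eigenvalues is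
        orthogonal to \<open>k\<close> and may be dropped from \<open>delta 0 - p\<close>; what
        remains is \<open>d\<close>, the sum of two tails that are small in l2.\<close>
      define c where "c = P (F - I0)"
      define d where "d g = coef (1 - P F) g + (coef (P ?F0) g - p g)" for g
      have split: "P F = P ?F0 + c"
        unfolding c_def P_def using F(1)
        by (subst sum.union_disjoint[symmetric]) (auto intro!: sum.cong)
      have star_c: "star c = c" using projP[of "F - I0"] F by (auto simp: c_def projection_def)
      have "conv (coef c) k 0 = 0"
      proof -
        have "conv (coef (\<Sum>i\<in>A. E i)) k 0 = 0" if "finite A" "A \<subseteq> F - I0" for A
          using that
        proof induction
          case empty
          show ?case by (simp add: conv_def supp_def)
        next
          case (insert i A)
          then show ?case using F E_k by (auto simp: conv_coef_add I0_def)
        qed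
        then show ?thesis using F by (simp add: c_def P_def)
      qed
      then have "cnj (\<Sum>y\<in>keys c. k y * cnj (coef c y)) = 0"
        by (simp only: conv_zero_self_adjoint[OF star_c] complex_cnj_zero)
      then have c_k: "l2_inner (coef c) k = 0"
        by (simp add: l2_inner_coef mult.commute)
      have d_alt: "d g = (delta 0 g - p g) - coef c g" for g
        by (simp add: d_def split lookup_minus lookup_add lookup_one delta_def when_def)
      have "d \<in> l2"
        unfolding d_alt using p_l2 by (intro l2_diff coef_in_l2) (simp_all add: delta_eq_coef coef_in_l2)
      have "l2_inner d k = l2_inner (\<lambda>g. delta 0 g - p g) k"
        unfolding d_alt using p_l2 k_l2 c_k
        by (subst l2_inner_diff_left) (auto simp: delta_eq_coef intro!: l2_diff coef_in_l2)
      moreover have "l2_le d (2 * (1 - sum \<tau> F) + 2 * (t0 - sum \<tau> ?F0))"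
        unfolding d_def
      proof (rule l2_le_add)
        show "l2_le (coef (1 - P F)) (1 - sum \<tau> F)"
          using l2_le_projection[OF projection_one_minus[OF projP[OF F]]]
          by (simp add: lookup_minus trP)
        show "l2_le (\<lambda>g. coef (P ?F0) g - p g) (t0 - sum \<tau> ?F0)"
          using tail[of ?F0] F by (simp add: l2_le_def norm_minus_commute)
      qed
      ultimately have "cmod (l2_inner (\<lambda>g. delta 0 g - p g) k)
          \<le> sqrt (2 * (1 - sum \<tau> F) + 2 * (t0 - sum \<tau> ?F0)) * sqrt r"
        using l2_inner_bound(2) r by metis
      moreover have "sqrt (2 * (1 - sum \<tau> F) + 2 * (t0 - sum \<tau> ?F0)) * sqrt r
          \<le> sqrt (4 * (1 - sum \<tau> F)) * sqrt r"
      proof -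
        \<comment> \<open>The traces over \<open>F - I0\<close> do not exceed those over
          \<open>I - I0\<close>, so the second tail \<open>t0 - sum \<tau> ?F0\<close> is at most
          the first, \<open>1 - sum \<tau> F\<close>; hence the factor 4.\<close>
        have tot: "infsum \<tau> I = 1" using total unfolding \<tau>_def by (rule infsumI)
        have "t0 + infsum \<tau> (I - I0) = 1"
          unfolding t0_def tot[symmetric] using I0 tau_sum
          by (subst infsum_Un_disjoint[symmetric])
            (auto intro: summable_on_subset simp: Un_absorb1)
        moreover have "sum \<tau> (F - I0) \<le> infsum \<tau> (I - I0)"
          using F tau_nonneg by (intro finite_sum_le_infsum summable_on_subset[OF tau_sum]) auto
        moreover have "sum \<tau> F = sum \<tau> ?F0 + sum \<tau> (F - I0)"
          using F(1) by (subst sum.union_disjoint[symmetric]) (auto intro!: sum.cong)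
        ultimately have "2 * (1 - sum \<tau> F) + 2 * (t0 - sum \<tau> ?F0) \<le> 4 * (1 - sum \<tau> F)"
          by (simp add: algebra_simps)
        then show ?thesis
          using l2_le_nonneg[OF r] by (intro mult_right_mono real_sqrt_le_mono) auto
      qed
      ultimately show ?thesis by linarith
    qed
    \<comment> \<open>The left side of \<open>bound\<close> does not depend on \<open>F\<close>, and
      the right side tends to 0 because the traces sum to 1.\<close>
    have "((\<lambda>F. sqrt (4 * (1 - sum \<tau> F)) * sqrt r) \<longlongrightarrow> sqrt (4 * (1 - 1)) * sqrt r)
        (finite_subsets_at_top I)"
      using total unfolding has_sum_def \<tau>_def[symmetric]
      by (intro tendsto_intros)
    then have "cmod (l2_inner (\<lambda>g. delta 0 g - p g) k) \<le> sqrt (4 * (1 - 1)) * sqrt r"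
      by (rule tendsto_lowerbound)
        (use bound in \<open>auto simp: eventually_finite_subsets_at_top\<close>)
    then show ?thesis by simp
  qed
  have "orth_proj (kernel_op (coef a)) (delta 0) = p"
    by (rule orth_proj_eqI[OF p_kernel ortho]) (simp_all add: delta_eq_coef coef_in_l2)
  then show ?thesis
    by (simp add: vn_dim_def l2_inner_delta p_def I0_def)
qed

section \<open>Spectra of paths\<close>

text \<open>Multiplication by \<open>2 * sin y\<close>, with \<open>y\<close> half of the angle
  step, makes the sum telescope; the divisibility hypothesis makes \<open>sin y\<close>
  nonzero.\<close>

lemma sum_cos_multiples:
  fixes r :: int
  assumes N: "N > 0" and r: "\<not> 2 * int N dvd r"
  shows "(\<Sum>i<N. cos (pi * r * real i / N)) = (1 - (-1) ^ nat \<bar>r\<bar>) / 2"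
proof -
  define y where "y = pi * r / (2 * N)"
  have siny: "sin y \<noteq> 0"
  proof
    assume "sin y = 0"
    then obtain k :: int where "y = k * pi" by (auto simp: sin_zero_iff_int2)
    then have "real_of_int r = of_int (k * (2 * int N))"
      using N by (simp add: y_def field_simps)
    then have "r = k * (2 * int N)" unfolding of_int_eq_iff .
    then show False using r by simp
  qed
  have tele: "2 * sin y * (\<Sum>i<M. cos (2 * y * real i)) = sin ((2 * real M - 1) * y) + sin y" for M
  proof (induction M)
    case (Suc M)
    have "2 * sin y * cos (2 * y * real M) = sin ((2 * real (Suc M) - 1) * y) - sin ((2 * real M - 1) * y)"
    proof -
      have a: "(2 * real (Suc M) - 1) * y = 2 * y * real M + y"
        and b: "(2 * real M - 1) * y = 2 * y * real M - y" by (simp_all add: algebra_simps)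
      show ?thesis unfolding a b sin_add sin_diff by simp
    qed
    then show ?case using Suc by (simp add: algebra_simps)
  qed simp
  have "cos (pi * r) = (-1) ^ nat \<bar>r\<bar>"
    by (cases "even r") (auto simp: minus_one_power_iff even_nat_iff mult.commute)
  moreover have "sin (pi * r) = 0" by (auto simp: sin_zero_iff_int2 mult.commute)
  moreover have "(2 * real N - 1) * y = pi * r - y"
    using N by (simp add: y_def field_simps)
  ultimately have "sin ((2 * real N - 1) * y) = - ((-1) ^ nat \<bar>r\<bar>) * sin y"
    by (simp add: sin_diff)
  then have "sin y * (2 * (\<Sum>i<N. cos (2 * y * real i))) = sin y * (1 - (-1) ^ nat \<bar>r\<bar>)"
    using tele[of N] by (simp add: algebra_simps)
  then have "2 * (\<Sum>i<N. cos (2 * y * real i)) = 1 - (-1) ^ nat \<bar>r\<bar>"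
    using siny by (metis mult_cancel_left)
  then have "(\<Sum>i<N. cos (2 * y * real i)) = (1 - (-1) ^ nat \<bar>r\<bar>) / 2"
    by simp
  moreover have "2 * y * real i = pi * r * real i / N" for i :: nat by (simp add: y_def)
  ultimately show ?thesis by simp
qed

text \<open>Product-to-sum leads to cosine sums for \<open>k - l\<close> and \<open>k + l\<close>.
  These numbers have the same parity, and for distinct \<open>k\<close> and \<open>l\<close> neither
  is a multiple of \<open>2 * (m + 1)\<close>, so the two sums cancel.\<close>

lemma sum_sin_mult_sin:
  fixes k l m :: nat
  assumes k: "1 \<le> k" "k \<le> m" and l: "1 \<le> l" "l \<le> m"
  shows "(\<Sum>i=1..m. sin (pi * k * real i / Suc m) * sin (pi * l * real i / Suc m))
    = (if k = l then Suc m / 2 else 0)"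
proof -
  let ?N = "Suc m"
  define C where "C r = (\<Sum>i<?N. cos (pi * of_int r * real i / ?N))" for r :: int
  have "(\<Sum>i=1..m. sin (pi * k * real i / ?N) * sin (pi * l * real i / ?N))
      = (\<Sum>i<?N. sin (pi * k * real i / ?N) * sin (pi * l * real i / ?N))"
    by (rule sum.mono_neutral_left) (auto simp: not_le)
  also have "\<dots> = (\<Sum>i<?N. (cos (pi * of_int (int k - int l) * real i / ?N) - cos (pi * of_int (int k + int l) * real i / ?N)) / 2)"
  proof (rule sum.cong)
    fix i
    have a: "pi * of_int (int k - int l) * real i / ?N = pi * k * real i / ?N - pi * l * real i / ?N"
      and b: "pi * of_int (int k + int l) * real i / ?N = pi * k * real i / ?N + pi * l * real i / ?N"
      by (simp_all add: algebra_simps add_divide_distrib diff_divide_distrib)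
    show "sin (pi * k * real i / ?N) * sin (pi * l * real i / ?N)
      = (cos (pi * of_int (int k - int l) * real i / ?N) - cos (pi * of_int (int k + int l) * real i / ?N)) / 2"
      unfolding a b by (simp add: cos_diff cos_add)
  qed simp
  also have "\<dots> = (C (int k - int l) - C (int k + int l)) / 2"
    by (simp only: C_def sum_subtractf sum_divide_distrib[symmetric])
  also have "\<dots> = (if k = l then ?N / 2 else 0)"
  proof -
    have plus: "C (int k + int l) = (1 - (-1) ^ nat \<bar>int k + int l\<bar>) / 2"
      unfolding C_def
    proof (rule sum_cos_multiples)
      show "\<not> 2 * int ?N dvd int k + int l"
        using k l zdvd_imp_le[of "2 * int ?N" "int k + int l"] by auto
    qed simp
    show ?thesis
    proof (cases "k = l")
      case True
      have "C 0 = ?N" by (simp add: C_def)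
      moreover have "C (int k + int l) = 0"
        unfolding plus using True by (simp add: minus_one_power_iff even_nat_iff)
      ultimately show ?thesis using True by simp
    next
      case False
      have "C (int k - int l) = (1 - (-1) ^ nat \<bar>int k - int l\<bar>) / 2"
        unfolding C_def
      proof (rule sum_cos_multiples)
        show "\<not> 2 * int ?N dvd int k - int l"
          using k l False dvd_imp_le_int[of "int k - int l" "2 * int ?N"] by auto
      qed simp
      moreover have "even (nat \<bar>int k - int l\<bar>) \<longleftrightarrow> even (nat \<bar>int k + int l\<bar>)"
        by (auto simp: even_nat_iff)
      then have "(-1 :: real) ^ nat \<bar>int k - int l\<bar> = (-1) ^ nat \<bar>int k + int l\<bar>"
        by (simp add: minus_one_power_iff)
      ultimately show ?thesis using False plus by simp
    qed
  qed
  finally show ?thesis .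
qed

section \<open>Coincidences between the eigenvalues of two paths\<close>

text \<open>After division by the gcd \<open>d\<close>, coprimality of \<open>a\<close> and
  \<open>b\<close> forces \<open>k = a * j\<close> and \<open>l = b * j\<close>; the bounds then
  mean \<open>0 < j < d\<close>.\<close>

lemma card_proportional_pairs:
  "card {(k, l). k \<in> {1..m} \<and> l \<in> {1..n} \<and> k * Suc n = l * Suc m} = gcd (Suc m) (Suc n) - 1"
proof -
  define d where "d = gcd (Suc m) (Suc n)"
  have d: "d > 0" by (simp add: d_def)
  obtain a b where ab: "Suc m = a * d" "Suc n = b * d" "coprime a b"
    using gcd_coprime_exists[of "Suc m" "Suc n"] d unfolding d_def by auto
  have a: "a > 0" and b: "b > 0" using ab by (auto intro!: gr0I)
  have "{(k, l). k \<in> {1..m} \<and> l \<in> {1..n} \<and> k * Suc n = l * Suc m} = (\<lambda>j. (a * j, b * j)) ` {1..<d}"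
    (is "?A = ?B")
  proof (intro equalityI subsetI)
    fix z assume "z \<in> ?A"
    then obtain k l where z: "z = (k, l)" and k: "1 \<le> k" "k < Suc m" and l: "1 \<le> l" and eq: "k * Suc n = l * Suc m"
      by auto
    have eq': "k * b = l * a" using eq d unfolding ab by simp
    then have "a dvd k * b" by simp
    then have "a dvd k" using ab(3) coprime_dvd_mult_left_iff by blast
    then obtain j where j: "k = a * j" ..
    then have "l = b * j" using eq' a by (auto simp: ac_simps)
    moreover have "1 \<le> j" using j k by (cases j) auto
    moreover have "j < d" using j k(2) a unfolding ab by simp
    ultimately show "z \<in> ?B" using z j by auto
  next
    fix z assume "z \<in> ?B"
    then obtain j where j: "1 \<le> j" "j < d" and z: "z = (a * j, b * j)" by auto
    have "a * j < Suc m" "b * j < Suc n" using j a b by (simp_all add: ab)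
    moreover have "1 \<le> a * j" "1 \<le> b * j" using j a b by simp_all
    moreover have "a * j * Suc n = b * j * Suc m" by (simp add: ab)
    ultimately show "z \<in> ?A" by (simp add: z)
  qed
  moreover have "inj_on (\<lambda>j. (a * j, b * j)) {1..<d}" using a by (auto simp: inj_on_def)
  ultimately show ?thesis by (simp add: card_image d_def)
qed

text \<open>Both angles lie in \<open>[0, pi]\<close>, where \<open>cos\<close> is injective. This
  decides when an eigenvalue of \<open>T\<close> equals one of \<open>S\<close>.\<close>

lemma cos_rational_eq_iff:
  fixes k l m n :: nat
  assumes "k \<le> m" "l \<le> n"
  shows "cos (pi * k / Suc m) = cos (pi * l / Suc n) \<longleftrightarrow> k * Suc n = l * Suc m"
proof -
  have "pi * k \<le> pi * Suc m" "pi * l \<le> pi * Suc n" using assms by auto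
  then have "0 \<le> pi * k / Suc m" "pi * k / Suc m \<le> pi" "0 \<le> pi * l / Suc n" "pi * l / Suc n \<le> pi"
    by (simp_all add: pos_divide_le_eq del: of_nat_Suc)
  then have "cos (pi * k / Suc m) = cos (pi * l / Suc n) \<longleftrightarrow> pi * k / Suc m = pi * l / Suc n"
    by (metis cos_inj_pi)
  also have "\<dots> \<longleftrightarrow> real (k * Suc n) = real (l * Suc m)"
    by (simp add: frac_eq_eq mult.assoc del: of_nat_Suc mult_Suc_right)
  finally show ?thesis unfolding of_nat_eq_iff .
qed

text \<open>Serves in \<open>T_E\<close> to move the neighbour shift of the path from the matrix
  units to the coefficients.\<close>

lemma sum_shift_down:
  fixes F :: "nat \<Rightarrow> nat \<Rightarrow> 'a::comm_monoid_add"
  shows "(\<Sum>i=1..m. if i < m then F i (Suc i) else 0) = (\<Sum>i=1..m. if 1 < i then F (i - 1) i else 0)"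
proof -
  have "(\<Sum>i=1..m. if i < m then F i (Suc i) else 0) = (\<Sum>i\<in>{i\<in>{1..m}. i < m}. F i (Suc i))"
    by (rule sum.inter_filter[symmetric]) simp
  also have "\<dots> = (\<Sum>i\<in>{i\<in>{1..m}. 1 < i}. F (i - 1) i)"
    by (rule sum.reindex_bij_witness[of _ "\<lambda>i. i - 1" Suc]) auto
  also have "\<dots> = (\<Sum>i=1..m. if 1 < i then F (i - 1) i else 0)"
    by (rule sum.inter_filter) simp
  finally show ?thesis .
qed

section \<open>Spectral projections of the adjacency matrix of a path\<close>

text \<open>Entry \<open>(i, j)\<close> of the projection onto the \<open>k\<close>-th eigenvector
  of the path with \<open>m\<close> vertices; the sine vector has squared norm
  \<open>(m + 1) / 2\<close>, whence the normalisation.\<close>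

definition sine_coeff :: "nat \<Rightarrow> nat \<Rightarrow> nat \<Rightarrow> nat \<Rightarrow> real" where
  "sine_coeff m k i j = 2 / real (Suc m) * sin (pi * k * i / Suc m) * sin (pi * k * j / Suc m)"

lemma sine_coeff_mult:
  assumes "k \<in> {1..m}" "l \<in> {1..m}"
  shows "(\<Sum>j=1..m. sine_coeff m k i j * sine_coeff m l j i') = (if k = l then sine_coeff m k i i' else 0)"
proof -
  have "(\<Sum>j=1..m. sine_coeff m k i j * sine_coeff m l j i')
      = (2 / real (Suc m))\<^sup>2 * sin (pi * k * i / Suc m) * sin (pi * l * i' / Suc m)
        * (\<Sum>j=1..m. sin (pi * k * j / Suc m) * sin (pi * l * j / Suc m))"
    unfolding sum_distrib_left
    by (rule sum.cong) (simp_all only: sine_coeff_def power2_eq_square mult_ac)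
  also have "\<dots> = (if k = l then sine_coeff m k i i' else 0)"
    using assms by (subst sum_sin_mult_sin) (auto simp: sine_coeff_def power2_eq_square)
  finally show ?thesis .
qed

lemma sine_coeff_trace:
  assumes "k \<in> {1..m}"
  shows "(\<Sum>i=1..m. sine_coeff m k i i) = 1"
proof -
  have "(\<Sum>i=1..m. sine_coeff m k i i)
      = 2 / real (Suc m) * (\<Sum>i=1..m. sin (pi * k * i / Suc m) * sin (pi * k * i / Suc m))"
    unfolding sum_distrib_left
    by (rule sum.cong) (simp_all only: sine_coeff_def mult_ac)
  also have "\<dots> = 1" using assms by (subst sum_sin_mult_sin) auto
  finally show ?thesis .
qed

text \<open>The addition formulas give \<open>sin (x - y) + sin (x + y) = 2 * cos y * sin x\<close>.
  The case distinctions change nothing, because the sine vanishes at the positions \<open>0\<close>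
  and \<open>m + 1\<close> just outside the path.\<close>

lemma sine_coeff_step:
  assumes "1 \<le> i" "i \<le> m"
  shows "(if 1 < i then sine_coeff m k (i - 1) j else 0) + (if i < m then sine_coeff m k (Suc i) j else 0)
    = 2 * cos (pi * k / Suc m) * sine_coeff m k i j"
proof -
  have first: "(if 1 < i then sine_coeff m k (i - 1) j else 0) = sine_coeff m k (i - 1) j"
    using assms by (auto simp: sine_coeff_def not_less)
  have last: "(if i < m then sine_coeff m k (Suc i) j else 0) = sine_coeff m k (Suc i) j"
  proof (cases "i < m")
    case False
    then have "pi * k * Suc i / Suc m = pi * k" using assms by simp
    then have "sin (pi * k * Suc i / Suc m) = 0" by (simp only: sin_npi2)
    then show ?thesis using False by (simp add: sine_coeff_def del: of_nat_Suc)
  qed simp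
  let ?x = "pi * k * i / Suc m" and ?y = "pi * k / Suc m"
  have "pi * k * real (i - 1) / Suc m = ?x - ?y"
    using assms by (simp add: of_nat_diff algebra_simps diff_divide_distrib)
  then have prev: "sin (pi * k * real (i - 1) / Suc m) = sin ?x * cos ?y - cos ?x * sin ?y"
    by (simp only: sin_diff)
  have "pi * k * real (Suc i) / Suc m = ?x + ?y"
    by (simp add: algebra_simps add_divide_distrib)
  then have "next": "sin (pi * k * real (Suc i) / Suc m) = sin ?x * cos ?y + cos ?x * sin ?y"
    by (simp only: sin_add)
  show ?thesis
    unfolding first last unfolding sine_coeff_def prev "next" by (simp add: algebra_simps)
qed

section \<open>Paths in the group ring of a wreath product\<close>

text \<open>\<open>wr_at 0\<close> is the embedding \<open>wr_base\<close> and
  \<open>wr_shift 1\<close> is \<open>wr_t\<close>; the other positions arise by conjugation with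
  shifts, see \<open>wr_shift_at\<close>.\<close>

definition wr_at :: "int \<Rightarrow> 'u::group_add \<Rightarrow> 'u wr" where
  "wr_at j u = abs_wr ((\<lambda>_. 0)(j := u), 0)"

definition wr_shift :: "int \<Rightarrow> 'u::group_add wr" where
  "wr_shift i = abs_wr (\<lambda>_. 0, i)"

lemma rep_wr_at: "rep_wr (wr_at j u) = ((\<lambda>_. 0)(j := u), 0)"
  unfolding wr_at_def by (rule abs_wr_inverse') simp

lemma rep_wr_shift: "rep_wr (wr_shift i) = (\<lambda>_. 0, i)"
  unfolding wr_shift_def by (rule abs_wr_inverse') simp

lemma wr_eqI: "rep_wr a = rep_wr b \<Longrightarrow> a = b"
  by (simp add: rep_wr_inject)

lemma wr_at_add: "wr_at j (u + v) = wr_at j u + wr_at j v"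
  by (rule wr_eqI) (auto simp: rep_plus rep_wr_at)

lemma wr_at_minus: "wr_at j (- u) = - wr_at j u"
  by (rule wr_eqI) (auto simp: rep_uminus rep_wr_at)

lemma wr_at_zero: "wr_at j 0 = 0"
  by (rule wr_eqI) (auto simp: rep_zero rep_wr_at)

lemma wr_at_commute: "i \<noteq> j \<Longrightarrow> wr_at i u + wr_at j v = wr_at j v + wr_at i u"
  by (rule wr_eqI) (auto simp: rep_plus rep_wr_at)

lemma inj_wr_at: "inj (wr_at j)"
proof (rule injI)
  fix u v :: 'a
  assume "wr_at j u = wr_at j v"
  then have "fst (rep_wr (wr_at j u)) j = fst (rep_wr (wr_at j v)) j" by simp
  then show "u = v" by (simp add: rep_wr_at)
qed

lemma wr_shift_add: "wr_shift i + wr_shift j = wr_shift (i + j)"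
  by (rule wr_eqI) (auto simp: rep_plus rep_wr_shift)

lemma wr_shift_minus: "- wr_shift i = wr_shift (- i)"
  by (rule wr_eqI) (auto simp: rep_uminus rep_wr_shift)

lemma wr_shift_diff: "wr_shift i - wr_shift j = wr_shift (i - j)"
  by (simp only: diff_conv_add_uminus wr_shift_minus wr_shift_add)

lemma wr_shift_zero: "wr_shift 0 = 0"
  by (rule wr_eqI) (auto simp: rep_zero rep_wr_shift)

lemma wr_shift_at: "wr_shift i + wr_at j u = wr_at (j - i) u + wr_shift i"
  by (rule wr_eqI) (auto simp: rep_plus rep_wr_at rep_wr_shift)

section \<open>Supports in the base group and independence\<close>

definition wr_supp :: "int set \<Rightarrow> 'u::group_add wr set" where
  "wr_supp J = {w. snd (rep_wr w) = 0 \<and> (\<forall>n. n \<notin> J \<longrightarrow> fst (rep_wr w) n = 0)}"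

lemma keys_mult_wr_supp:
  assumes "keys a \<subseteq> wr_supp J" "keys b \<subseteq> wr_supp K"
  shows "keys (a * b) \<subseteq> wr_supp (J \<union> K)"
proof
  fix x assume "x \<in> keys (a * b)"
  then obtain y z where "x = y + z" "y \<in> keys a" "z \<in> keys b"
    using keys_mult by blast
  then show "x \<in> wr_supp (J \<union> K)"
    using assms by (fastforce simp: wr_supp_def rep_plus)
qed

lemma keys_one_minus_wr_supp:
  assumes "keys a \<subseteq> wr_supp J"
  shows "keys (1 - a) \<subseteq> wr_supp J"
proof
  fix x assume "x \<in> keys (1 - a)"
  then have "x = 0 \<or> x \<in> keys a" by (auto simp: in_keys_iff lookup_minus lookup_one when_def split: if_splits)
  then show "x \<in> wr_supp J" using assms by (auto simp: wr_supp_def rep_zero)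
qed

text \<open>Elements living at disjoint positions are independent for the trace: only the identity
  is supported both in \<open>J\<close> and in \<open>K\<close>.\<close>

lemma coef_mult_wr_supp:
  assumes "keys a \<subseteq> wr_supp J" "keys b \<subseteq> wr_supp K" "J \<inter> K = {}"
  shows "coef (a * b) 0 = coef a 0 * coef b 0"
proof (rule coef_mult_zero_disjoint)
  fix x assume "x \<in> keys a" "- x \<in> keys b"
  then have x: "x \<in> wr_supp J" and "- x \<in> wr_supp K" using assms by auto
  then have "snd (rep_wr x) = 0" and "fst (rep_wr x) n = 0" for n
    using assms(3) by (auto simp: wr_supp_def rep_uminus)
  then show "x = 0" by (intro wr_eqI) (auto simp: rep_zero prod_eq_iff)
qed

section \<open>The translated projections and the operator \<open>T\<close>\<close>

locale wreath_projection =
  fixes p :: "'u::group_add \<Rightarrow>\<^sub>0 complex"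
  assumes projection_p: "projection p"
begin

definition f :: "int \<Rightarrow> 'u wr \<Rightarrow>\<^sub>0 complex" where
  "f j = push_alg (wr_at j) p"

definition t :: "int \<Rightarrow> 'u wr \<Rightarrow>\<^sub>0 complex" where
  "t i = single (wr_shift i) 1"

definition T :: "'u wr \<Rightarrow>\<^sub>0 complex" where
  "T = f 0 * t 1 + t (- 1) * f 0"

lemma projection_f: "projection (f j)"
  using projection_p
  by (simp add: projection_def f_def push_alg_star wr_at_minus push_alg_mult[symmetric] wr_at_add)

lemma f_idem: "f j * f j = f j" and star_f [simp]: "star (f j) = f j"
  using projection_f by (auto simp: projection_def)

lemma f_commute: "f i * f j = f j * f i"
  by (cases "i = j") (auto simp: f_def intro: push_alg_commute wr_at_commute)

lemma t_mult: "t i * t j = t (i + j)"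
  by (simp add: t_def mult_single wr_shift_add)

lemma t_zero [simp]: "t 0 = 1"
  by (simp add: t_def wr_shift_zero)

lemma star_t [simp]: "star (t i) = t (- i)"
  by (simp add: t_def wr_shift_minus)

text \<open>Conjugation by the shift moves position \<open>j\<close> to \<open>j + i\<close>; the
  later relations between \<open>f\<close> and \<open>t\<close> come from this.\<close>

lemma f_t: "f j * t i = t i * f (j + i)"
proof -
  have "single (wr_shift i) 1 * push_alg (wr_at (j + i)) a = push_alg (wr_at j) a * single (wr_shift i) 1"
    for a :: "'u \<Rightarrow>\<^sub>0 complex"
    by (induction a rule: poly_mapping_add_induct)
      (simp_all add: mult_single wr_shift_at distrib_left distrib_right)
  then show ?thesis by (simp add: f_def t_def)
qed

lemma star_T: "star T = T"
  by (simp add: T_def add.commute)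

text \<open>\<open>mid n\<close> is the product of \<open>f 2\<close>, ...,
  \<open>f (n + 1)\<close>, the interior factors of \<open>q (n + 1)\<close>.\<close>

primrec mid :: "nat \<Rightarrow> 'u wr \<Rightarrow>\<^sub>0 complex" where
  "mid 0 = 1"
| "mid (Suc n) = mid n * f (int n + 2)"

text \<open>The \<open>t\<close>-translates of \<open>q m\<close> span a copy of the path with \<open>m\<close> vertices, on which \<open>T\<close> acts
as the adjacency matrix: \<open>q m\<close> is the left end point, \<open>f 1\<close> and \<open>f (m + 1)\<close> cut the path off.\<close>
definition q :: "nat \<Rightarrow> 'u wr \<Rightarrow>\<^sub>0 complex" where
  "q m = (1 - f 1) * mid (m - 1) * (1 - f (int m + 1))"

lemma f_mid_commute: "f j * mid n = mid n * f j"
proof (induction n)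
  case (Suc n)
  have "f j * mid (Suc n) = mid n * (f j * f (int n + 2))"
    using Suc by (simp add: mult.assoc[symmetric])
  then show ?case by (simp add: f_commute[of j] mult.assoc)
qed simp

lemma f_mid:
  assumes "2 \<le> j" "j \<le> int n + 1"
  shows "mid n * f j = mid n"
  using assms
proof (induction n)
  case (Suc n)
  show ?case
  proof (cases "j = int n + 2")
    case True
    then show ?thesis by (simp add: mult.assoc f_idem)
  next
    case False
    have "mid (Suc n) * f j = mid n * f j * f (int n + 2)"
      by (simp add: mult.assoc f_commute[of j])
    then show ?thesis using Suc False by simp
  qed
qed simp

lemma star_mid [simp]: "star (mid n) = mid n"
  by (induction n) (simp_all add: f_mid_commute)

lemma f_q_commute: "f j * q m = q m * f j"
proof -
  have comm: "f j * (1 - f i) = (1 - f i) * f j" for i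
    by (simp add: algebra_simps f_commute)
  have "f j * q m = (f j * (1 - f 1)) * mid (m - 1) * (1 - f (int m + 1))"
    by (simp add: q_def mult.assoc)
  also have "\<dots> = (1 - f 1) * (f j * mid (m - 1)) * (1 - f (int m + 1))"
    by (simp only: comm mult.assoc)
  also have "\<dots> = (1 - f 1) * mid (m - 1) * (f j * (1 - f (int m + 1)))"
    by (simp only: f_mid_commute mult.assoc)
  also have "\<dots> = q m * f j"
    by (simp only: comm q_def mult.assoc)
  finally show ?thesis .
qed

lemma f_q_first: "f 1 * q m = 0"
  by (simp add: q_def mult.assoc[symmetric] right_diff_distrib f_idem)

lemma f_q_last: "q m * f (int m + 1) = 0"
  by (simp add: q_def mult.assoc left_diff_distrib f_idem)

lemma f_q_mid:
  assumes "2 \<le> j" "j \<le> int m"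
  shows "q m * f j = q m"
proof -
  have "q m * f j = (1 - f 1) * (mid (m - 1) * f j) * (1 - f (int m + 1))"
    by (simp add: q_def algebra_simps f_commute[of j])
  then show ?thesis using assms f_mid[of j "m - 1"] by (simp add: q_def)
qed

lemma star_q [simp]: "star (q m) = q m"
proof -
  have comm_mid: "mid n * (1 - f i) = (1 - f i) * mid n" for i n
    by (simp add: algebra_simps f_mid_commute)
  have comm: "(1 - f i) * (1 - f j) = (1 - f j) * (1 - f i)" for i j
    by (simp add: algebra_simps f_commute)
  have "star (q m) = (1 - f (int m + 1)) * (mid (m - 1) * (1 - f 1))"
    by (simp add: q_def)
  also have "\<dots> = ((1 - f (int m + 1)) * (1 - f 1)) * mid (m - 1)"
    by (simp only: comm_mid mult.assoc)
  also have "\<dots> = (1 - f 1) * ((1 - f (int m + 1)) * mid (m - 1))"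
    by (simp only: comm[of "int m + 1"] mult.assoc)
  also have "\<dots> = (1 - f 1) * (mid (m - 1) * (1 - f (int m + 1)))"
    by (simp only: comm_mid)
  finally show ?thesis by (simp add: q_def mult.assoc)
qed

text \<open>A copy of \<open>q m\<close> absorbs every factor of \<open>q m\<close>, so the left
  copy is removed factor by factor.\<close>

lemma q_idem: "q m * q m = q m"
proof -
  have "mid n * q m = q m * mid n" for n
  proof (induction n)
    case (Suc n)
    then show ?case by (simp add: mult.assoc f_q_commute) (simp add: mult.assoc[symmetric])
  qed simp
  note mid_q = this
  have q_mid: "q m * mid (m - 1) = q m"
  proof -
    have "q m * mid n = q m" if "int n + 1 \<le> int m" for n
      using that by (induction n) (simp_all add: f_q_mid mult.assoc[symmetric])
    \<comment> \<open>For \<open>m = 0\<close> the truncated \<open>m - 1\<close> is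
      \<open>0\<close>, and the product is empty.\<close>
    moreover have "q 0 * mid 0 = q 0" by simp
    ultimately show ?thesis by (cases m) auto
  qed
  have "q m * q m = (1 - f 1) * (mid (m - 1) * ((1 - f (int m + 1)) * q m))"
    by (subst (1) q_def) (simp only: mult.assoc)
  also have "(1 - f (int m + 1)) * q m = q m"
    by (simp add: left_diff_distrib f_q_commute f_q_last)
  also have "mid (m - 1) * q m = q m" by (simp only: mid_q q_mid)
  also have "(1 - f 1) * q m = q m" by (simp add: left_diff_distrib f_q_first)
  finally show ?thesis .
qed

section \<open>Matrix units attached to the paths\<close>

definition M :: "nat \<Rightarrow> nat \<Rightarrow> nat \<Rightarrow> 'u wr \<Rightarrow>\<^sub>0 complex" where
  "M m i j = t (int i) * q m * t (- int j)"

lemma star_M [simp]: "star (M m i j) = M m j i"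
  by (simp add: M_def mult.assoc)

text \<open>For \<open>d > 0\<close> the factor \<open>1 - f 1\<close> of \<open>q m\<close> passes
  \<open>t d\<close> as \<open>1 - f (1 + d)\<close> and meets \<open>f (1 + d)\<close> inside
  \<open>q m'\<close>. For \<open>d < 0\<close> the factor \<open>f (1 - d)\<close> of
  \<open>q m\<close> passes as \<open>f 1\<close> and meets \<open>1 - f 1\<close>. For
  \<open>d = 0\<close> the shorter path ends inside the longer one. The bounds on \<open>d\<close>
  hold for the differences \<open>i' - j\<close> of vertices in \<open>M_mult\<close>.\<close>

lemma q_t_q:
  assumes "- int m < d" "d < int m'"
  shows "q m * t d * q m' = (if d = 0 \<and> m = m' then q m else 0)"
proof -
  have pos: "q m * t d * q m' = 0" if "d > 0"
  proof -
    have "q m * t d * q m' = q m * (1 - f 1) * t d * q m'"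
      by (simp add: right_diff_distrib f_q_commute[symmetric] f_q_first)
    also have "\<dots> = q m * t d * ((1 - f (1 + d)) * q m')"
      by (simp add: algebra_simps f_t)
    also have "(1 - f (1 + d)) * q m' = 0"
      using that assms by (simp add: left_diff_distrib f_q_commute f_q_mid)
    finally show ?thesis by simp
  qed
  have neg: "q m * t d * q m' = 0" if "d < 0"
  proof -
    have "q m * t d * q m' = q m * f (1 - d) * t d * q m'"
      using that assms by (simp add: f_q_mid)
    also have "\<dots> = q m * t d * (f 1 * q m')"
      by (simp add: mult.assoc f_t mult.assoc[of "f _" "t _" "q _", symmetric])
    finally show ?thesis by (simp add: f_q_first)
  qed
  have ne: "q m * q m' = 0" if "m < m'" "0 < m" for m m' :: nat
  proof -
    have "q m * q m' = q m * (1 - f (int m + 1)) * q m'"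
      by (simp add: right_diff_distrib f_q_last)
    also have "\<dots> = q m * ((1 - f (int m + 1)) * q m')" by (simp add: mult.assoc)
    also have "(1 - f (int m + 1)) * q m' = 0"
      using that by (simp add: left_diff_distrib f_q_commute f_q_mid)
    finally show ?thesis by simp
  qed
  have ne': "q m * q m' = 0" if "m' < m" "0 < m'" for m m' :: nat
    using arg_cong[OF ne[OF that], of star] by simp
  show ?thesis
  proof (cases "d = 0")
    case True
    with assms have "0 < m" "0 < m'" by auto
    then show ?thesis using True ne ne' by (cases m m' rule: linorder_cases) (auto simp: q_idem)
  next
    case False
    then show ?thesis using pos neg by (cases "d > 0") auto
  qed
qed

lemma M_mult:
  assumes "i \<in> {1..m}" "j \<in> {1..m}" "i' \<in> {1..m'}" "j' \<in> {1..m'}"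
  shows "M m i j * M m' i' j' = (if m = m' \<and> j = i' then M m i j' else 0)"
proof -
  have "M m i j * M m' i' j' = t (int i) * (q m * (t (- int j) * t (int i')) * q m') * t (- int j')"
    by (simp add: M_def mult.assoc)
  also have "t (- int j) * t (int i') = t (int i' - int j)"
    by (simp add: t_mult)
  also have "q m * t (int i' - int j) * q m' = (if m = m' \<and> j = i' then q m else 0)"
    using assms by (subst q_t_q) auto
  finally show ?thesis by (simp add: M_def)
qed

text \<open>\<open>f 0\<close> moves past \<open>t\<close> and reaches \<open>q m\<close> as
  \<open>f (i + 1)\<close> or \<open>f i\<close>. Inside the path it is absorbed; at an end it meets
  \<open>1 - f (m + 1)\<close> or \<open>1 - f 1\<close> and gives 0, so no step leaves the
  path.\<close>

lemma T_M:
  assumes "i \<in> {1..m}"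
  shows "T * M m i j = (if i < m then M m (Suc i) j else 0) + (if 1 < i then M m (i - 1) j else 0)"
proof -
  have "T * M m i j = f 0 * (t 1 * t (int i)) * q m * t (- int j) + t (- 1) * (f 0 * t (int i)) * q m * t (- int j)"
    by (simp add: T_def M_def algebra_simps)
  also have "f 0 * (t 1 * t (int i)) = t (int i + 1) * f (int i + 1)"
    by (simp add: t_mult f_t add.commute)
  also have "t (- 1) * (f 0 * t (int i)) = t (int i - 1) * f (int i)"
    by (simp add: f_t mult.assoc[symmetric] t_mult)
  also have "t (int i + 1) * f (int i + 1) * q m = (if i < m then t (int i + 1) * q m else 0)"
    using assms f_q_last[of m] by (auto simp: mult.assoc f_q_commute f_q_mid not_less)
  also have "t (int i - 1) * f (int i) * q m = (if 1 < i then t (int i - 1) * q m else 0)"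
    using assms f_q_first[of m] by (auto simp: mult.assoc f_q_commute f_q_mid not_less)
  finally show ?thesis using assms by (auto simp: M_def add.commute of_nat_diff)
qed

section \<open>Eigenprojections of \<open>T\<close>\<close>

definition E :: "nat \<Rightarrow> nat \<Rightarrow> 'u wr \<Rightarrow>\<^sub>0 complex" where
  "E m k = (\<Sum>i=1..m. \<Sum>j=1..m. scal (sine_coeff m k i j) * M m i j)"

lemma star_E: "star (E m k) = E m k"
proof -
  have "star (E m k) = (\<Sum>i=1..m. \<Sum>j=1..m. scal (sine_coeff m k i j) * M m j i)"
    by (simp add: E_def scal_commute)
  also have "\<dots> = (\<Sum>j=1..m. \<Sum>i=1..m. scal (sine_coeff m k i j) * M m j i)"
    by (rule sum.swap)
  also have "\<dots> = E m k"
    unfolding E_def by (intro sum.cong) (auto simp: sine_coeff_def mult_ac)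
  finally show ?thesis .
qed

text \<open>Matrix units multiply like elementary matrices, so the claim reduces to
  \<open>sine_coeff_mult\<close>; different \<open>m\<close> are orthogonal already at the level of
  \<open>M\<close>.\<close>

lemma E_mult:
  assumes k: "k \<in> {1..m}" and l: "l \<in> {1..m'}"
  shows "E m k * E m' l = (if m = m' \<and> k = l then E m k else 0)"
proof -
  have "E m k * E m' l = (\<Sum>i=1..m. \<Sum>i'=1..m'. \<Sum>j=1..m. \<Sum>j'=1..m'.
      scal (sine_coeff m k i j * sine_coeff m' l i' j') * (M m i j * M m' i' j'))"
    unfolding E_def sum_product
    by (intro sum.cong refl scal_mult_scal_mult)
  also have "\<dots> = (\<Sum>i=1..m. \<Sum>j=1..m. \<Sum>i'=1..m'. \<Sum>j'=1..m'.
      scal (sine_coeff m k i j * sine_coeff m' l i' j') * (M m i j * M m' i' j'))"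
    by (rule sum.cong[OF refl sum.swap])
  also have "\<dots> = (\<Sum>i=1..m. \<Sum>j=1..m. \<Sum>i'=1..m'. \<Sum>j'=1..m'.
      if m = m' \<and> j = i' then scal (sine_coeff m k i j * sine_coeff m' l i' j') * M m i j' else 0)"
    by (intro sum.cong refl) (simp add: M_mult)
  also have "\<dots> = (if m = m' \<and> k = l then E m k else 0)"
  proof (cases "m = m'")
    case True
    have "(\<Sum>i=1..m. \<Sum>j=1..m. \<Sum>i'=1..m. \<Sum>j'=1..m.
        if j = i' then scal (sine_coeff m k i j * sine_coeff m l i' j') * M m i j' else 0)
      = (\<Sum>i=1..m. \<Sum>j=1..m. \<Sum>j'=1..m. scal (sine_coeff m k i j * sine_coeff m l j j') * M m i j')"
    proof (rule sum.cong[OF refl], rule sum.cong[OF refl])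
      fix i j assume "j \<in> {1..m}"
      have "(\<Sum>i'=1..m. \<Sum>j'=1..m. if j = i' then scal (sine_coeff m k i j * sine_coeff m l i' j') * M m i j' else 0)
        = (\<Sum>i'=1..m. if j = i' then \<Sum>j'=1..m. scal (sine_coeff m k i j * sine_coeff m l i' j') * M m i j' else 0)"
        by (intro sum.cong) auto
      then show "(\<Sum>i'=1..m. \<Sum>j'=1..m. if j = i' then scal (sine_coeff m k i j * sine_coeff m l i' j') * M m i j' else 0)
        = (\<Sum>j'=1..m. scal (sine_coeff m k i j * sine_coeff m l j j') * M m i j')"
        using \<open>j \<in> {1..m}\<close> by simp
    qed
    also have "\<dots> = (\<Sum>i=1..m. \<Sum>j'=1..m. scal (\<Sum>j=1..m. sine_coeff m k i j * sine_coeff m l j j') * M m i j')"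
      unfolding scal_sum sum_distrib_right by (rule sum.cong[OF refl sum.swap])
    also have "\<dots> = (if k = l then E m k else 0)"
      using k l True by (simp only: sine_coeff_mult) (simp add: E_def)
    finally show ?thesis unfolding True[symmetric] by simp
  qed simp
  finally show ?thesis .
qed

lemma projection_E: "k \<in> {1..m} \<Longrightarrow> projection (E m k)"
  by (simp add: projection_def star_E E_mult)

text \<open>In each column \<open>j\<close>, \<open>T\<close> acts on the index \<open>i\<close> as
  the adjacency matrix of the path. Shifting the summation index transfers this action to the
  coefficients, where \<open>sine_coeff_step\<close> applies.\<close>

lemma T_E: "T * E m k = scal (2 * cos (pi * k / Suc m)) * E m k"
proof -
  have "T * E m k = (\<Sum>i=1..m. \<Sum>j=1..m. scal (sine_coeff m k i j) * (T * M m i j))"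
    by (simp add: E_def sum_distrib_left mult_scal_mult)
  also have "\<dots> = (\<Sum>j=1..m. \<Sum>i=1..m. scal (sine_coeff m k i j) * (T * M m i j))"
    by (rule sum.swap)
  also have "\<dots> = (\<Sum>j=1..m. \<Sum>i=1..m. scal (2 * cos (pi * k / Suc m)) * (scal (sine_coeff m k i j) * M m i j))"
  proof (rule sum.cong[OF refl])
    fix j
    have "(\<Sum>i=1..m. scal (sine_coeff m k i j) * (T * M m i j))
      = (\<Sum>i=1..m. (if i < m then scal (sine_coeff m k i j) * M m (Suc i) j else 0)
          + (if 1 < i then scal (sine_coeff m k i j) * M m (i - 1) j else 0))"
      by (intro sum.cong refl) (simp add: T_M distrib_left)
    \<comment> \<open>\<open>Suc (i - 1)\<close> is \<open>i\<close> where \<open>1 < i\<close>; in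
      this form \<open>sum_shift_down\<close> can be read from right to left.\<close>
    also have "\<dots> = (\<Sum>i=1..m. if i < m then scal (sine_coeff m k i j) * M m (Suc i) j else 0)
          + (\<Sum>i=1..m. if 1 < i then scal (sine_coeff m k (Suc (i - 1)) j) * M m (i - 1) j else 0)"
      unfolding sum.distrib by (intro arg_cong2[where f = "(+)"] sum.cong refl) auto
    also have "(\<Sum>i=1..m. if i < m then scal (sine_coeff m k i j) * M m (Suc i) j else 0)
        = (\<Sum>i=1..m. if 1 < i then scal (sine_coeff m k (i - 1) j) * M m i j else 0)"
      by (rule sum_shift_down)
    also have "(\<Sum>i=1..m. if 1 < i then scal (sine_coeff m k (Suc (i - 1)) j) * M m (i - 1) j else 0)
        = (\<Sum>i=1..m. if i < m then scal (sine_coeff m k (Suc i) j) * M m i j else 0)"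
      using sum_shift_down[of m "\<lambda>i i'. scal (sine_coeff m k (Suc i) j) * M m i j", symmetric] by simp
    also have "(\<Sum>i=1..m. if 1 < i then scal (sine_coeff m k (i - 1) j) * M m i j else 0)
        + (\<Sum>i=1..m. if i < m then scal (sine_coeff m k (Suc i) j) * M m i j else 0)
      = (\<Sum>i=1..m. scal ((if 1 < i then sine_coeff m k (i - 1) j else 0)
          + (if i < m then sine_coeff m k (Suc i) j else 0)) * M m i j)"
      unfolding sum.distrib[symmetric] by (intro sum.cong refl) (auto simp: scal_add distrib_right)
    also have "\<dots> = (\<Sum>i=1..m. scal (2 * cos (pi * k / Suc m)) * (scal (sine_coeff m k i j) * M m i j))"
      by (intro sum.cong refl, subst sine_coeff_step) (auto simp: scal_mult mult.assoc)
    finally show "(\<Sum>i=1..m. scal (sine_coeff m k i j) * (T * M m i j))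
      = (\<Sum>i=1..m. scal (2 * cos (pi * k / Suc m)) * (scal (sine_coeff m k i j) * M m i j))" .
  qed
  also have "\<dots> = (\<Sum>i=1..m. \<Sum>j=1..m. scal (2 * cos (pi * k / Suc m)) * (scal (sine_coeff m k i j) * M m i j))"
    by (rule sum.swap)
  finally show ?thesis by (simp add: E_def sum_distrib_left)
qed

section \<open>Traces of the eigenprojections\<close>

lemma keys_f: "keys (f j) \<subseteq> wr_supp {j}"
  using keys_push_alg[of "wr_at j" p] unfolding f_def
  by (auto simp: wr_supp_def rep_wr_at)

lemma coef_f_zero: "coef (f j) 0 = coef p 0"
  using coef_push_alg_inj[OF inj_wr_at, of j p 0] by (simp add: f_def wr_at_zero)

lemma keys_mid: "keys (mid n) \<subseteq> wr_supp {2..int n + 1}"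
proof (induction n)
  case 0
  then show ?case by (auto simp: wr_supp_def rep_zero)
next
  case (Suc n)
  have "{2..int n + 1} \<union> {int n + 2} = {2..int (Suc n) + 1}" by auto
  then show ?case using keys_mult_wr_supp[OF Suc keys_f, of "int n + 2"] by simp
qed

lemma coef_mid_zero: "coef (mid n) 0 = coef p 0 ^ n"
proof (induction n)
  case (Suc n)
  have "coef (mid (Suc n)) 0 = coef (mid n) 0 * coef (f (int n + 2)) 0"
    unfolding mid.simps by (rule coef_mult_wr_supp[OF keys_mid keys_f]) simp
  then show ?case using Suc by (simp add: coef_f_zero)
qed simp

lemma keys_q: "keys (q m) \<subseteq> wr_supp UNIV"
  using keys_mult_wr_supp[OF keys_mult_wr_supp[OF keys_one_minus_wr_supp[OF keys_f] keys_mid]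
      keys_one_minus_wr_supp[OF keys_f], of 1 "m - 1" "int m + 1"]
  unfolding q_def by (auto simp: wr_supp_def)

text \<open>The three factors live at the disjoint positions \<open>1\<close>, \<open>2..m\<close>
  and \<open>m + 1\<close>, so their traces multiply.\<close>

lemma coef_q_zero:
  assumes "1 \<le> m"
  shows "coef (q m) 0 = (1 - coef p 0)\<^sup>2 * coef p 0 ^ (m - 1)"
proof -
  have "coef (q m) 0 = coef ((1 - f 1) * mid (m - 1)) 0 * coef (1 - f (int m + 1)) 0"
    unfolding q_def
    by (rule coef_mult_wr_supp[OF keys_mult_wr_supp[OF keys_one_minus_wr_supp[OF keys_f] keys_mid]
          keys_one_minus_wr_supp[OF keys_f]]) (use assms in auto)
  also have "coef ((1 - f 1) * mid (m - 1)) 0 = coef (1 - f 1) 0 * coef (mid (m - 1)) 0"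
    by (rule coef_mult_wr_supp[OF keys_one_minus_wr_supp[OF keys_f] keys_mid]) simp
  finally show ?thesis
    by (simp add: lookup_minus coef_f_zero coef_mid_zero power2_eq_square)
qed

text \<open>The coefficient at \<open>0\<close> is that of \<open>q m\<close> at the pure shift by
  \<open>j - i\<close>, while \<open>q m\<close> lives in the base group.\<close>

lemma coef_M_zero: "coef (M m i j) 0 = (if i = j then coef (q m) 0 else 0)"
proof -
  have "coef (M m i j) 0 = coef (q m) (wr_shift (int j - int i))"
    by (simp add: M_def t_def coef_mult_single coef_single_mult mult.assoc wr_shift_minus wr_shift_diff)
  moreover have "wr_shift d \<notin> keys (q m)" if "d \<noteq> 0" for d
    using keys_q[of m] that by (auto simp: wr_supp_def rep_wr_shift)
  ultimately show ?thesis by (auto simp: in_keys_iff wr_shift_zero)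
qed

text \<open>Only the diagonal contributes, and the sine matrix, a projection of rank one, has trace
  1.\<close>

lemma coef_E_zero:
  assumes "k \<in> {1..m}"
  shows "coef (E m k) 0 = (1 - coef p 0)\<^sup>2 * coef p 0 ^ (m - 1)"
proof -
  have "coef (E m k) 0 = (\<Sum>i=1..m. \<Sum>j=1..m. if i = j then of_real (sine_coeff m k i j) * coef (q m) 0 else 0)"
    unfolding E_def lookup_sum coef_scal_mult coef_M_zero by (intro sum.cong refl) simp
  also have "\<dots> = of_real (\<Sum>i=1..m. sine_coeff m k i i) * coef (q m) 0"
    by (simp add: sum_distrib_right)
  finally show ?thesis
    unfolding sine_coeff_trace[OF assms] using assms by (simp add: coef_q_zero)
qed

text \<open>Links \<open>T\<close> to the form in which the final theorem writes it, with
  \<open>conv\<close> and \<open>push\<close>.\<close>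

lemma coef_T:
  "coef T = (\<lambda>g. conv (push wr_base (coef p)) (delta wr_t) g + conv (delta (- wr_t)) (push wr_base (coef p)) g)"
proof -
  have "f 0 = push_alg wr_base p"
    unfolding f_def by (rule arg_cong[of _ _ "\<lambda>\<phi>. push_alg \<phi> p"])
      (simp add: fun_eq_iff wr_base_def wr_at_def)
  moreover have "t 1 = single wr_t 1"
    by (simp add: t_def wr_t_def wr_shift_def)
  moreover have "t (- 1) = single (- wr_t) 1"
    using star_t[of 1] by (simp add: calculation)
  ultimately show ?thesis
    by (simp add: fun_eq_iff T_def lookup_add coef_mult coef_push_alg delta_eq_coef)
qed

end

section \<open>Products of groups\<close>

text \<open>The images of the two factors commute, so this realises the tensor product of the group
  rings inside the group ring of the direct product.\<close>

definition tensor :: "('u::group_add \<Rightarrow>\<^sub>0 complex) \<Rightarrow> ('v::group_add \<Rightarrow>\<^sub>0 complex) \<Rightarrow> 'u \<times> 'v \<Rightarrow>\<^sub>0 complex" where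
  "tensor a b = push_alg (\<lambda>u. (u, 0)) a * push_alg (\<lambda>v. (0, v)) b"

lemma tensor_mult: "tensor a b * tensor c d = tensor (a * c) (b * d)"
proof -
  let ?l = "push_alg (\<lambda>u. (u, 0 :: 'b))" and ?r = "push_alg (\<lambda>v. (0 :: 'a, v))"
  have "tensor a b * tensor c d = ?l a * (?r b * ?l c) * ?r d"
    by (simp add: tensor_def mult.assoc)
  also have "?r b * ?l c = ?l c * ?r b"
    by (rule push_alg_commute) simp
  finally show ?thesis
    by (simp add: tensor_def push_alg_mult mult.assoc)
qed

lemma star_tensor: "star (tensor a b) = tensor (star a) (star b)"
  unfolding tensor_def star_mult
  by (subst push_alg_commute) (simp_all add: push_alg_star)

lemma tensor_zero_left [simp]: "tensor 0 b = 0"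
  by (simp add: tensor_def)

lemma tensor_zero_right [simp]: "tensor a 0 = 0"
  by (simp add: tensor_def)

lemma projection_tensor: "projection a \<Longrightarrow> projection b \<Longrightarrow> projection (tensor a b)"
  by (simp add: projection_def star_tensor tensor_mult)

lemma tensor_scal_left: "tensor (scal c * a) b = scal c * tensor a b"
  by (simp add: tensor_def push_alg_mult scal_def mult.assoc zero_prod_def)

lemma tensor_scal_right: "tensor a (scal c * b) = scal c * tensor a b"
  by (simp add: tensor_def push_alg_mult scal_def mult.assoc zero_prod_def[symmetric] single_zero_mult_commute
      flip: mult.assoc)

lemma coef_tensor_zero: "coef (tensor a b) 0 = coef a 0 * coef b 0"
proof -
  let ?\<iota> = "\<lambda>u. (u, 0 :: 'b)" and ?\<kappa> = "\<lambda>v. (0 :: 'a, v)"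
  have "coef (tensor a b) 0 = coef (push_alg ?\<iota> a) 0 * coef (push_alg ?\<kappa> b) 0"
    unfolding tensor_def
  proof (rule coef_mult_zero_disjoint)
    fix z :: "'a \<times> 'b"
    assume "z \<in> keys (push_alg ?\<iota> a)" "- z \<in> keys (push_alg ?\<kappa> b)"
    then show "z = 0"
      using keys_push_alg[of ?\<iota> a] keys_push_alg[of ?\<kappa> b] by (auto simp: prod_eq_iff)
  qed
  also have "coef (push_alg ?\<iota> a) 0 = coef a 0"
    using coef_push_alg_inj[of ?\<iota> a 0] by (simp add: inj_def zero_prod_def)
  also have "coef (push_alg ?\<kappa> b) 0 = coef b 0"
    using coef_push_alg_inj[of ?\<kappa> b 0] by (simp add: inj_def zero_prod_def)
  finally show ?thesis .
qed

section \<open>The dimension formula\<close>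

text \<open>The argument yields unordered sums over pairs, whereas the final formula has iterated
  ordered series.\<close>

lemma has_sum_nat_prod_imp_suminf:
  fixes F :: "nat \<Rightarrow> nat \<Rightarrow> complex"
  assumes "((\<lambda>(m, n). F m n) has_sum s) (UNIV \<times> UNIV)"
  shows "(\<Sum>m. \<Sum>n. F m n) = s"
proof -
  have inner: "(F m has_sum infsum (F m) UNIV) UNIV" for m
    using assms by (intro has_sum_infsum summable_on_SigmaD1[of F UNIV "\<lambda>_. UNIV"])
      (auto simp: has_sum_imp_summable)
  have "((\<lambda>m. infsum (F m) UNIV) has_sum s) UNIV"
    by (rule has_sum_SigmaD[OF assms]) (use inner in simp)
  moreover have "(\<Sum>n. F m n) = infsum (F m) UNIV" for m
    using has_sum_imp_sums[OF inner] by (rule sums_unique[symmetric])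
  ultimately show ?thesis
    by (simp add: has_sum_imp_sums sums_unique[symmetric])
qed

text \<open>Nonnegativity supplies summability over the product set.\<close>

lemma has_sum_prod_nonneg:
  fixes g :: "'a \<Rightarrow> real" and h :: "'b \<Rightarrow> real"
  assumes g: "(g has_sum a) A" and h: "(h has_sum b) B"
    and nonneg: "\<And>x. x \<in> A \<Longrightarrow> 0 \<le> g x" "\<And>y. y \<in> B \<Longrightarrow> 0 \<le> h y"
  shows "((\<lambda>(x, y). g x * h y) has_sum (a * b)) (A \<times> B)"
proof -
  have inner: "((\<lambda>y. case (x, y) of (x, y) \<Rightarrow> g x * h y) has_sum (g x * b)) B" for x
    using has_sum_cmult_right[OF h] by simp
  have outer: "((\<lambda>x. g x * b) has_sum (a * b)) A"
    by (rule has_sum_cmult_left[OF g])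
  show ?thesis
    by (rule has_sum_SigmaI[OF inner outer summable_on_SigmaI[OF inner]])
      (use outer nonneg in \<open>auto intro: has_sum_imp_summable\<close>)
qed

section \<open>Labels and weights of the eigenprojections\<close>

definition path_index :: "(nat \<times> nat) set" where
  "path_index = (SIGMA m:UNIV. {1..m})"

text \<open>The truncated \<open>m - 1\<close> at \<open>m = 0\<close> is harmless: no index in \<open>path_index\<close> has \<open>m = 0\<close>.\<close>
definition path_weight :: "real \<Rightarrow> nat \<Rightarrow> real" where
  "path_weight \<alpha> m = (1 - \<alpha>)\<^sup>2 * \<alpha> ^ (m - 1)"

lemma path_weight_nonneg: "0 \<le> \<alpha> \<Longrightarrow> 0 \<le> path_weight \<alpha> m"
  by (simp add: path_weight_def)

text \<open>Each \<open>m\<close> occurs with \<open>m\<close> values of \<open>k\<close>, and the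
  sum of \<open>m * \<alpha> ^ (m - 1)\<close> is the derivative of the geometric series. This is
  the completeness of the eigenprojections.\<close>

lemma has_sum_path_weight:
  assumes "0 < \<alpha>" "\<alpha> < 1"
  shows "((\<lambda>(m, k). path_weight \<alpha> m) has_sum 1) path_index"
proof -
  have inner: "((\<lambda>k. case (m, k) of (m, k) \<Rightarrow> path_weight \<alpha> m) has_sum (real m * path_weight \<alpha> m)) {1..m}" for m
    by (rule has_sum_finiteI) auto
  have "(\<lambda>n. real (Suc n) * \<alpha> ^ n) sums (1 / (1 - \<alpha>)\<^sup>2)"
    using geometric_deriv_sums[of \<alpha>] assms by simp
  then have "(\<lambda>n. (1 - \<alpha>)\<^sup>2 * (real (Suc n) * \<alpha> ^ n)) sums ((1 - \<alpha>)\<^sup>2 * (1 / (1 - \<alpha>)\<^sup>2))"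
    by (rule sums_mult)
  then have "(\<lambda>n. real (Suc n) * path_weight \<alpha> (Suc n)) sums 1"
    using assms by (simp add: path_weight_def mult_ac)
  \<comment> \<open>The added term at \<open>m = 0\<close> vanishes.\<close>
  then have "(\<lambda>m. real m * path_weight \<alpha> m) sums 1"
    by (subst (asm) sums_Suc_iff) simp
  then have outer: "((\<lambda>m. real m * path_weight \<alpha> m) has_sum 1) UNIV"
    by (rule sums_nonneg_imp_has_sum) (use assms in \<open>simp add: path_weight_nonneg\<close>)
  show ?thesis
    unfolding path_index_def
    by (rule has_sum_SigmaI[OF inner outer summable_on_SigmaI[OF inner]])
      (use outer assms in \<open>auto intro: has_sum_imp_summable path_weight_nonneg\<close>)
qed

lemma has_sum_inverse_powers:
  assumes "1 < (x :: real)"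
  shows "((\<lambda>m. 1 / x ^ Suc m) has_sum (1 / (x - 1))) UNIV"
proof -
  have "(\<lambda>m. (1 / x) * (1 / x) ^ m) sums ((1 / x) * (1 / (1 - 1 / x)))"
    using assms by (intro sums_mult geometric_sums) auto
  also have "(1 / x) * (1 / (1 - 1 / x)) = 1 / (x - 1)" using assms by (simp add: field_simps)
  also have "(\<lambda>m. (1 / x) * (1 / x) ^ m) = (\<lambda>m. 1 / x ^ Suc m)" by (simp add: power_divide)
  finally show ?thesis
    by (rule sums_nonneg_imp_has_sum) (use assms in simp)
qed

lemma path_weight_inverse:
  assumes "1 < x" "1 \<le> m"
  shows "path_weight (1 / x) m = (x - 1)\<^sup>2 / x ^ Suc m"
proof -
  obtain n where "m = Suc n" using assms(2) by (cases m) auto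
  then show ?thesis using assms(1) by (simp add: path_weight_def field_simps power2_eq_square)
qed

section \<open>The gcd series\<close>

definition matching_pairs :: "nat \<Rightarrow> nat \<Rightarrow> (nat \<times> nat) set" where
  "matching_pairs m n = {(k, l). k \<in> {1..m} \<and> l \<in> {1..n} \<and> k * Suc n = l * Suc m}"

lemma finite_matching_pairs: "finite (matching_pairs m n)"
  by (rule finite_subset[of _ "{1..m} \<times> {1..n}"]) (auto simp: matching_pairs_def)

text \<open>Grouping the index set by \<open>(m, n)\<close> gives
  \<open>gcd (m + 1) (n + 1) - 1\<close> equal terms. Division by the constant turns each weight
  into \<open>1 / (x ^ Suc m * y ^ Suc n)\<close>, and the missing 1 is restored by a double
  geometric series of sum \<open>1 / ((x - 1) * (y - 1))\<close>.\<close>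

lemma has_sum_gcd_series:
  fixes x y :: real
  assumes x: "1 < x" and y: "1 < y"
    and L: "((\<lambda>((m, k), (n, l)). path_weight (1 / x) m * path_weight (1 / y) n) has_sum L)
      {((m, k), (n, l)). k \<in> {1..m} \<and> l \<in> {1..n} \<and> k * Suc n = l * Suc m}"
  shows "((\<lambda>(m, n). real (gcd (Suc m) (Suc n)) / (x ^ Suc m * y ^ Suc n)) has_sum
      (L / ((x - 1)\<^sup>2 * (y - 1)\<^sup>2) + 1 / ((x - 1) * (y - 1)))) (UNIV \<times> UNIV)"
proof -
  let ?F = "\<lambda>m n. path_weight (1 / x) m * path_weight (1 / y) n"
  note L
  also have "?this \<longleftrightarrow> ((\<lambda>((m, n), (k, l)). ?F m n) has_sum L) (SIGMA (m, n):UNIV \<times> UNIV. matching_pairs m n)"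
    by (rule has_sum_reindex_bij_witness[of _ "\<lambda>((m, n), (k, l)). ((m, k), (n, l))" "\<lambda>((m, k), (n, l)). ((m, n), (k, l))"])
      (auto simp: matching_pairs_def)
  finally have "((\<lambda>(m, n). real (card (matching_pairs m n)) * ?F m n) has_sum L) (UNIV \<times> UNIV)"
    by (rule has_sum_SigmaD) (auto intro!: has_sum_finiteI simp: finite_matching_pairs)
  then have "((\<lambda>z. (case z of (m, n) \<Rightarrow> real (card (matching_pairs m n)) * ?F m n) / ((x - 1)\<^sup>2 * (y - 1)\<^sup>2))
      has_sum (L / ((x - 1)\<^sup>2 * (y - 1)\<^sup>2))) (UNIV \<times> UNIV)"
    by (rule has_sum_divide_const)
  moreover have "((\<lambda>(m, n). 1 / x ^ Suc m * (1 / y ^ Suc n)) has_sum (1 / (x - 1) * (1 / (y - 1)))) (UNIV \<times> UNIV)"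
    using x y by (intro has_sum_prod_nonneg has_sum_inverse_powers) auto
  ultimately have "((\<lambda>z. (case z of (m, n) \<Rightarrow> real (card (matching_pairs m n)) * ?F m n) / ((x - 1)\<^sup>2 * (y - 1)\<^sup>2)
      + (case z of (m, n) \<Rightarrow> 1 / x ^ Suc m * (1 / y ^ Suc n))) has_sum
      (L / ((x - 1)\<^sup>2 * (y - 1)\<^sup>2) + 1 / (x - 1) * (1 / (y - 1)))) (UNIV \<times> UNIV)"
    by (rule has_sum_add)
  moreover have "real (card (matching_pairs m n)) * ?F m n / ((x - 1)\<^sup>2 * (y - 1)\<^sup>2) + 1 / x ^ Suc m * (1 / y ^ Suc n)
    = real (gcd (Suc m) (Suc n)) / (x ^ Suc m * y ^ Suc n)" for m n
  proof (cases "m = 0 \<or> n = 0")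
    \<comment> \<open>Here there are no pairs and the gcd is 1, so the geometric series alone gives
      the right term; \<open>path_weight_inverse\<close> covers only positive indices.\<close>
    case True
    then have "matching_pairs m n = {}" by (auto simp: matching_pairs_def)
    then show ?thesis using True by auto
  next
    case False
    have "real (card (matching_pairs m n)) = real (gcd (Suc m) (Suc n)) - 1"
      unfolding matching_pairs_def card_proportional_pairs
      by (subst of_nat_diff) (auto simp: Suc_le_eq simp del: gcd_Suc_0)
    then show ?thesis
      using False x y by (simp add: path_weight_inverse field_simps)
  qed
  ultimately show ?thesis
    by (simp add: case_prod_unfold)
qed

text \<open>Tensors of eigenprojections of \<open>T\<close> and of \<open>S\<close> satisfy the
  hypotheses of \<open>vn_dim_kernel_eigenprojections\<close>, with differences of eigenvalues as
  \<open>\<mu>\<close>; the traces over its zeros are summed by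
  \<open>has_sum_gcd_series\<close>.\<close>

theorem vn_dim_wreath_product:
  fixes p :: "'u::group_add \<Rightarrow>\<^sub>0 complex" and r :: "'v::group_add \<Rightarrow>\<^sub>0 complex"
  assumes p: "projection p" and r: "projection r"
    and x: "coef p 0 = of_real (1 / x)" "1 < x" and y: "coef r 0 = of_real (1 / y)" "1 < y"
  shows "vn_dim (kernel_op (coef (tensor (wreath_projection.T p) 1 - tensor 1 (wreath_projection.T r))))
    = of_real ((x - 1)\<^sup>2 * (y - 1)\<^sup>2) * (\<Sum>m. \<Sum>n. of_real (real (gcd (Suc m) (Suc n)) / (x ^ Suc m * y ^ Suc n)))
      - of_real ((x - 1) * (y - 1))"
proof -
  interpret U: wreath_projection p by standard (rule p)
  interpret V: wreath_projection r by standard (rule r)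
  define a where "a = tensor U.T 1 - tensor 1 V.T"
  define EE where "EE = (\<lambda>((m, k), (n, l)). tensor (U.E m k) (V.E n l))"
  define \<mu> where "\<mu> = (\<lambda>((m, k), (n, l)). 2 * cos (pi * real k / real (Suc m)) - 2 * cos (pi * real l / real (Suc n)))"
  define \<tau> where "\<tau> = (\<lambda>((m, k :: nat), (n, l :: nat)). path_weight (1 / x) m * path_weight (1 / y) n)"
  define I where "I = path_index \<times> path_index"
  have tr: "coef (EE i) 0 = of_real (\<tau> i)" if "i \<in> I" for i
    using that
    by (auto simp: I_def path_index_def EE_def \<tau>_def coef_tensor_zero U.coef_E_zero V.coef_E_zero x y path_weight_def)
  have total: "(\<tau> has_sum 1) I"
  proof -
    have "((\<lambda>(s, s'). (case s of (m, k) \<Rightarrow> path_weight (1 / x) m) * (case s' of (n, l) \<Rightarrow> path_weight (1 / y) n))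
      has_sum (1 * 1)) I"
      unfolding I_def
      by (intro has_sum_prod_nonneg has_sum_path_weight) (use x y in \<open>auto simp: path_weight_nonneg\<close>)
    then show ?thesis by (simp add: \<tau>_def case_prod_unfold)
  qed
  have "vn_dim (kernel_op (coef a)) = (\<Sum>\<^sub>\<infinity>i\<in>{i\<in>I. \<mu> i = 0}. coef (EE i) 0)"
  proof (rule vn_dim_kernel_eigenprojections)
    show "star a = a" by (simp add: a_def star_tensor U.star_T V.star_T)
    show "projection (EE i)" if "i \<in> I" for i
      using that by (auto simp: I_def path_index_def EE_def intro!: projection_tensor U.projection_E V.projection_E)
    show "EE i * EE j = 0" if "i \<in> I" "j \<in> I" "i \<noteq> j" for i j
      using that by (auto simp: I_def path_index_def EE_def tensor_mult U.E_mult V.E_mult split: if_split_asm)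
    show "a * EE i = single 0 (of_real (\<mu> i)) * EE i" if "i \<in> I" for i
    proof -
      obtain m k n l where i: "i = ((m, k), (n, l))" by (metis surj_pair)
      have "a * EE i = tensor (U.T * U.E m k) (V.E n l) - tensor (U.E m k) (V.T * V.E n l)"
        by (simp add: a_def EE_def i left_diff_distrib tensor_mult)
      also have "\<dots> = scal (2 * cos (pi * k / Suc m)) * EE i - scal (2 * cos (pi * l / Suc n)) * EE i"
        by (simp only: U.T_E V.T_E tensor_scal_left tensor_scal_right) (simp add: EE_def i)
      also have "\<dots> = scal (\<mu> i) * EE i"
        by (simp add: \<mu>_def i scal_def single_diff left_diff_distrib)
      finally show ?thesis by (simp add: scal_def)
    qed
    show "((\<lambda>i. Re (coef (EE i) 0)) has_sum 1) I"
      using total by (rule has_sum_cong[THEN iffD1, rotated]) (simp add: tr)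
  qed
  also have "{i\<in>I. \<mu> i = 0} = {((m, k), (n, l)). k \<in> {1..m} \<and> l \<in> {1..n} \<and> k * Suc n = l * Suc m}" (is "_ = ?I0")
    by (auto simp: I_def path_index_def \<mu>_def cos_rational_eq_iff simp del: mult_Suc_right of_nat_Suc)
  finally have dim: "vn_dim (kernel_op (coef a)) = (\<Sum>\<^sub>\<infinity>i\<in>?I0. coef (EE i) 0)" .
  have I0: "?I0 \<subseteq> I" by (auto simp: I_def path_index_def)
  define L where "L = infsum \<tau> ?I0"
  have L: "(\<tau> has_sum L) ?I0"
    unfolding L_def by (rule has_sum_infsum[OF summable_on_subset[OF has_sum_imp_summable[OF total] I0]])
  have "(\<Sum>\<^sub>\<infinity>i\<in>?I0. coef (EE i) 0) = (\<Sum>\<^sub>\<infinity>i\<in>?I0. of_real (\<tau> i))"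
    by (rule infsum_cong) (rule tr[OF subsetD[OF I0]])
  also have "\<dots> = of_real L" by (intro infsumI has_sum_of_real L)
  finally have dim_L: "vn_dim (kernel_op (coef a)) = of_real L" unfolding dim .
  define s where "s = L / ((x - 1)\<^sup>2 * (y - 1)\<^sup>2) + 1 / ((x - 1) * (y - 1))"
  have "((\<lambda>(m, n). real (gcd (Suc m) (Suc n)) / (x ^ Suc m * y ^ Suc n)) has_sum s) (UNIV \<times> UNIV)"
    unfolding s_def using L unfolding \<tau>_def by (rule has_sum_gcd_series[OF x(2) y(2)])
  from has_sum_of_real[OF this, where 'a = complex]
  have "(\<Sum>m. \<Sum>n. of_real (real (gcd (Suc m) (Suc n)) / (x ^ Suc m * y ^ Suc n))) = (of_real s :: complex)"
    by (intro has_sum_nat_prod_imp_suminf) (simp only: case_prod_unfold)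
  moreover have "L = (x - 1)\<^sup>2 * (y - 1)\<^sup>2 * s - (x - 1) * (y - 1)"
  proof -
    have "L = u\<^sup>2 * v\<^sup>2 * (L / (u\<^sup>2 * v\<^sup>2) + 1 / (u * v)) - u * v" if "u \<noteq> 0" "v \<noteq> 0" for u v
      using that by (simp add: field_simps power2_eq_square)
    from this[of "x - 1" "y - 1"] show ?thesis using x(2) y(2) by (simp add: s_def)
  qed
  ultimately show ?thesis
    unfolding a_def[symmetric] dim_L by simp
qed

theorem theorem4p1:
  fixes e :: "'u::group_add \<Rightarrow> complex" and f :: "'v::group_add \<Rightarrow> complex"
    and X Y :: complex
    and T :: "'u wr \<Rightarrow> complex" and S :: "'v wr \<Rightarrow> complex"
  assumes "has_torsion TYPE('u)" and "has_torsion TYPE('v)"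
    and "nontrivial_projection e" and "nontrivial_projection f"
    and "X = inverse (tr e)" and "Y = inverse (tr f)"
    and "T = (\<lambda>g. conv (push wr_base e) (delta wr_t) g + conv (delta (- wr_t)) (push wr_base e) g)"
    and "S = (\<lambda>g. conv (push wr_base f) (delta wr_t) g + conv (delta (- wr_t)) (push wr_base f) g)"
  shows "vn_dim (kernel_op (\<lambda>g. push (\<lambda>x. (x, 0 :: 'v wr)) T g - push (\<lambda>y. (0 :: 'u wr, y)) S g))
       = (X - 1)\<^sup>2 * (Y - 1)\<^sup>2
           * (\<Sum>m. \<Sum>n. of_nat (gcd (Suc m) (Suc n)) / (X ^ Suc m * Y ^ Suc n))
         - (X - 1) * (Y - 1)"
proof -
  \<comment> \<open>Both \<open>p\<close> and \<open>1 - p\<close> are nonzero projections, so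
    faithfulness puts the trace strictly between 0 and 1; \<open>x\<close> is its inverse.\<close>
  have trace: "\<exists>x. coef p 0 = of_real (1 / x) \<and> 1 < x" if "projection p" "p \<noteq> 0" "p \<noteq> 1"
    for p :: "'w::group_add \<Rightarrow>\<^sub>0 complex"
  proof -
    have "0 < Re (coef p 0)" using that by (intro projection_trace_pos)
    moreover have "0 < Re (coef (1 - p) 0)"
      using that by (intro projection_trace_pos projection_one_minus) auto
    ultimately show ?thesis
      using projection_trace_real[OF that(1)]
      by (intro exI[of _ "1 / Re (coef p 0)"]) (simp add: lookup_minus)
  qed
  obtain p where p: "e = coef p" "projection p" "p \<noteq> 0" "p \<noteq> 1"
    using nontrivial_projectionE[OF assms(3)] .
  obtain r where r: "f = coef r" "projection r" "r \<noteq> 0" "r \<noteq> 1"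
    using nontrivial_projectionE[OF assms(4)] .
  obtain x where x: "coef p 0 = of_real (1 / x)" "1 < x" using trace[OF p(2-4)] by blast
  obtain y where y: "coef r 0 = of_real (1 / y)" "1 < y" using trace[OF r(2-4)] by blast
  have X: "X = of_real x" and Y: "Y = of_real y"
    using assms(5,6) x y by (simp_all add: tr_def p r)
  interpret U: wreath_projection p by standard (rule p)
  interpret V: wreath_projection r by standard (rule r)
  have "T = coef U.T" "S = coef V.T" using assms(7,8) by (simp_all add: p r U.coef_T V.coef_T)
  \<comment> \<open>The embedding of a factor maps 1 to 1, so tensoring with 1 is just the embedding
    of the other factor.\<close>
  then have "(\<lambda>g. push (\<lambda>x. (x, 0 :: 'v wr)) T g - push (\<lambda>y. (0 :: 'u wr, y)) S g)
      = coef (tensor U.T 1 - tensor 1 V.T)"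
    by (auto simp: tensor_def push_alg_one zero_prod_def coef_push_alg lookup_minus)
  then show ?thesis
    using vn_dim_wreath_product[OF p(2) r(2) x y] by (simp add: X Y)
qed

end
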